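(* Let $\mathbf{k}$ be a field of characteristic zero, let $S=\mathbb{Z}_{\ge 0}^n$ be the first octant with standard basis $e_1,\dots,e_n$, and let $I\subset\mathbf{k}[S]$ be a full monomial ideal with cofinite support. Let $i\neq j$ and assume that the semigroup automorphism of $S$ permuting $e_i$ with $e_j$ and leaving $e_k$ fixed for $k\neq i,j$ induces a toric automorphism $\tau_{ij}\colon\mathbf{k}[S]/I\to\mathbf{k}[S]/I$. Then $\tau_{ij}$ belongs to $\operatorname{Aut}^0_{\mathbf{k}}(\mathbf{k}[S]/I)$ if and only if $e_i-e_j$ and $e_j-e_i$ both belong to $\mathcal{R}(S,I)$.
   Context: $\mathbf{k}[S]=\mathbf{k}[x_1,\dots,x_n]$, with $\mathbf{x}^m=x_1^{m_1}\cdots x_n^{m_n}$. A monomial ideal is one generated by finitely many monomials; $\operatorname{supp}(I)=\{m\in S\mid\mathbf{x}^m\in I\}$. $I$ has cofinite support if $S\setminus\operatorname{supp}(I)$ is finite. $I$ is full if no $e_i$ lies in $\operatorname{supp}(I)$, i.e. no variable belongs to $I$. $\operatorname{Aut}_{\mathbf{k}}(\mathbf{k}[S]/I)$ is the group of $\mathbf{k}$-algebra automorphisms, a linear algebraic group, and $\operatorname{Aut}^0_{\mathbf{k}}$ is its identity component. A toric automorphism of $\mathbf{k}[S]/I$ is an automorphism of the form $\overline{\mathbf{x}}^m\mapsto\overline{\mathbf{x}}^{\widehat g(m)}$ for a semigroup automorphism $\widehat g\colon S\to S$ with $\widehat g(\operatorname{supp}(I))=\operatorname{supp}(I)$, where $\overline{\mathbf{x}}^m$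 is the class of $\mathbf{x}^m$. $\mathcal{R}(S,I)\subset M=\mathbb{Z}^n$ is the set of those $\alpha\in M$ for which there is a non-zero nilpotent $\mathbf{k}$-derivation of $\mathbf{k}[S]/I$ that is homogeneous of degree $\alpha$ for the $\mathbb{Z}^n$-grading (where $\overline{\mathbf{x}}^m$ has degree $m$) and liftable, that is, induced by a derivation $\partial$ of $\mathbf{k}[S]$ with $\partial(I)\subset I$. Such a derivation has the form $\overline{\partial}_{\alpha,p}\colon\overline{\mathbf{x}}^m\mapsto p(m)\overline{\mathbf{x}}^{m+\alpha}$ for some $p\in\operatorname{Hom}(M,\mathbf{k})$. *)

theory Defs
  imports
    "HOL-Analysis.Analysis"
    "HOL-Library.Poly_Mapping"
    "HOL-Algebra.Algebra"
    "HOL-Algebra.Algebraic_Closure_Type"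
begin

text \<open>
  A commutative \<open>k\<close>-algebra is given by a ring record \<open>A\<close> together with its structure map
  \<open>\<eta>\<close> from the type \<open>'k\<close> to \<open>carrier A\<close>.
\<close>

section \<open>Automorphism group, Zariski topology, identity component\<close>

definition alg_automorphisms ::
    "('a, 'm) ring_scheme \<Rightarrow> ('k \<Rightarrow> 'a) \<Rightarrow> ('a \<Rightarrow> 'a) set" where
  "alg_automorphisms A \<eta> =
     {\<phi> \<in> ring_hom A A \<inter> Bij (carrier A). \<forall>c. \<phi> (\<eta> c) = \<eta> c}"

definition alg_AutoGroup ::
    "('a, 'm) ring_scheme \<Rightarrow> ('k \<Rightarrow> 'a) \<Rightarrow> ('a \<Rightarrow> 'a) monoid" where
  "alg_AutoGroup A \<eta> = BijGroup (carrier A) \<lparr>carrier := alg_automorphisms A \<eta>\<rparr>"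

definition linear_functionals ::
    "('a, 'm) ring_scheme \<Rightarrow> ('k::field \<Rightarrow> 'a) \<Rightarrow> ('a \<Rightarrow> 'k) set" where
  "linear_functionals A \<eta> =
     {l. (\<forall>a\<in>carrier A. \<forall>b\<in>carrier A. l (a \<oplus>\<^bsub>A\<^esub> b) = l a + l b) \<and>
         (\<forall>c. \<forall>a\<in>carrier A. l (\<eta> c \<otimes>\<^bsub>A\<^esub> a) = c * l a)}"

text \<open>
  Polynomial functions on the space of \<open>k\<close>-linear endomorphisms of a finite-dimensional \<open>A\<close>,
  described without choosing a basis: the maps \<open>\<phi> \<mapsto> l (\<phi> a)\<close> span the linear forms (matrix
  entries) on that space.
\<close>

inductive_set polynomial_functions ::
    "('a, 'm) ring_scheme \<Rightarrow> ('k::field \<Rightarrow> 'a) \<Rightarrow> (('a \<Rightarrow> 'a) \<Rightarrow> 'k) set"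
  for A :: "('a, 'm) ring_scheme" and \<eta> :: "'k::field \<Rightarrow> 'a" where
  const: "(\<lambda>_. c) \<in> polynomial_functions A \<eta>"
| entry: "\<lbrakk>l \<in> linear_functionals A \<eta>; a \<in> carrier A\<rbrakk> \<Longrightarrow>
            (\<lambda>\<phi>. l (\<phi> a)) \<in> polynomial_functions A \<eta>"
| add: "\<lbrakk>F \<in> polynomial_functions A \<eta>; G \<in> polynomial_functions A \<eta>\<rbrakk> \<Longrightarrow>
            (\<lambda>\<phi>. F \<phi> + G \<phi>) \<in> polynomial_functions A \<eta>"
| mult: "\<lbrakk>F \<in> polynomial_functions A \<eta>; G \<in> polynomial_functions A \<eta>\<rbrakk> \<Longrightarrow>
            (\<lambda>\<phi>. F \<phi> * G \<phi>) \<in> polynomial_functions A \<eta>"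

text \<open>
  The Zariski topology on the \<open>k\<close>-points of the linear algebraic group of automorphisms,
  generated by the principal open sets.  Inverting the determinant does not change the
  topology, so polynomial functions suffice.
\<close>

definition Aut_zariski ::
    "('a, 'm) ring_scheme \<Rightarrow> ('k::field \<Rightarrow> 'a) \<Rightarrow> ('a \<Rightarrow> 'a) topology" where
  "Aut_zariski A \<eta> = topology_generated_by
     ((\<lambda>F. {\<phi> \<in> alg_automorphisms A \<eta>. F \<phi> \<noteq> 0}) ` polynomial_functions A \<eta>)"

lemma topspace_Aut_zariski: "topspace (Aut_zariski A \<eta>) = alg_automorphisms A \<eta>"
proof -
  have "(\<lambda>_. 1) \<in> polynomial_functions A \<eta>" by (rule polynomial_functions.const)
  then show ?thesis
    unfolding Aut_zariski_def topology_generated_by_topspace by force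
qed

lemma openin_Aut_zariski_iff:
  fixes A :: "('a, 'm) ring_scheme" and \<eta> :: "'k::field \<Rightarrow> 'a"
  shows "openin (Aut_zariski A \<eta>) U \<longleftrightarrow>
     (\<exists>P \<subseteq> polynomial_functions A \<eta>. U = {\<phi> \<in> alg_automorphisms A \<eta>. \<exists>F\<in>P. F \<phi> \<noteq> 0})"
proof
  let ?D = "\<lambda>P. {\<phi> \<in> alg_automorphisms A \<eta>. \<exists>F\<in>P. F \<phi> \<noteq> 0}"
  assume "openin (Aut_zariski A \<eta>) U"
  then have "generate_topology_on
      ((\<lambda>F. {\<phi> \<in> alg_automorphisms A \<eta>. F \<phi> \<noteq> 0}) ` polynomial_functions A \<eta>) U"
    by (simp add: Aut_zariski_def openin_topology_generated_by_iff)
  then show "\<exists>P \<subseteq> polynomial_functions A \<eta>. U = ?D P"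
  proof induction
    case Empty
    show ?case by (rule exI[of _ "{}"]) simp
  next
    case (Int a b)
    then obtain P Q where P: "P \<subseteq> polynomial_functions A \<eta>" "a = ?D P"
      and Q: "Q \<subseteq> polynomial_functions A \<eta>" "b = ?D Q" by (elim exE conjE)
    let ?PQ = "(\<lambda>(F, G) \<phi>. F \<phi> * G \<phi>) ` (P \<times> Q)"
    have "?PQ \<subseteq> polynomial_functions A \<eta>"
      using P(1) Q(1) by (auto intro: polynomial_functions.mult)
    moreover have "a \<inter> b = ?D ?PQ"
      unfolding P(2) Q(2) by auto
    ultimately show ?case by (intro exI[of _ ?PQ] conjI)
  next
    case (UN K)
    then have "\<forall>k\<in>K. \<exists>P. P \<subseteq> polynomial_functions A \<eta> \<and> k = ?D P"
      by (intro ballI) (rule UN.IH)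
    from bchoice[OF this] obtain p
      where p: "\<forall>k\<in>K. p k \<subseteq> polynomial_functions A \<eta> \<and> k = ?D (p k)" by (elim exE)
    have sub: "p k \<subseteq> polynomial_functions A \<eta>" if "k \<in> K" for k
      by (rule bspec[OF p that, THEN conjunct1])
    have eq: "?D (p k) = k" if "k \<in> K" for k
      by (rule bspec[OF p that, THEN conjunct2, symmetric])
    have "\<Union>K = (\<Union>k\<in>K. ?D (p k))" by (simp add: eq)
    also have "\<dots> = ?D (\<Union>k\<in>K. p k)" by auto
    finally have "\<Union>K = ?D (\<Union>k\<in>K. p k)" .
    moreover have "(\<Union>k\<in>K. p k) \<subseteq> polynomial_functions A \<eta>" by (intro UN_least sub)
    ultimately show ?case by (intro exI[of _ "\<Union>k\<in>K. p k"] conjI)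
  next
    case (Basis s)
    then obtain F where "F \<in> polynomial_functions A \<eta>"
      "s = {\<phi> \<in> alg_automorphisms A \<eta>. F \<phi> \<noteq> 0}" by (elim imageE)
    then show ?case by (intro exI[of _ "{F}"]) simp
  qed
next
  assume "\<exists>P \<subseteq> polynomial_functions A \<eta>.
    U = {\<phi> \<in> alg_automorphisms A \<eta>. \<exists>F\<in>P. F \<phi> \<noteq> 0}"
  then obtain P where P: "P \<subseteq> polynomial_functions A \<eta>"
    and U: "U = {\<phi> \<in> alg_automorphisms A \<eta>. \<exists>F\<in>P. F \<phi> \<noteq> 0}" by (elim exE conjE)
  have "openin (Aut_zariski A \<eta>) {\<phi> \<in> alg_automorphisms A \<eta>. F \<phi> \<noteq> 0}" if "F \<in> P" for F
    unfolding Aut_zariski_def using P that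
    by (intro topology_generated_by_Basis imageI) (rule subsetD)
  then have "openin (Aut_zariski A \<eta>) (\<Union>F\<in>P. {\<phi> \<in> alg_automorphisms A \<eta>. F \<phi> \<noteq> 0})"
    by (intro openin_Union) (elim imageE, simp)
  moreover have "U = (\<Union>F\<in>P. {\<phi> \<in> alg_automorphisms A \<eta>. F \<phi> \<noteq> 0})"
    unfolding U by auto
  ultimately show "openin (Aut_zariski A \<eta>) U" by simp
qed

text \<open>The closed sets are the zero loci of sets of polynomial functions.\<close>

lemma closedin_Aut_zariski_iff:
  fixes A :: "('a, 'm) ring_scheme" and \<eta> :: "'k::field \<Rightarrow> 'a"
  shows "closedin (Aut_zariski A \<eta>) Z \<longleftrightarrow>
     (\<exists>P \<subseteq> polynomial_functions A \<eta>. Z = {\<phi> \<in> alg_automorphisms A \<eta>. \<forall>F\<in>P. F \<phi> = 0})"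
proof -
  have "Z \<subseteq> B \<and> B - Z = {\<phi> \<in> B. \<exists>F\<in>P. F \<phi> \<noteq> 0} \<longleftrightarrow> Z = {\<phi> \<in> B. \<forall>F\<in>P. F \<phi> = 0}"
    for B :: "('a \<Rightarrow> 'a) set" and P :: "(('a \<Rightarrow> 'a) \<Rightarrow> 'k) set"
  proof -
    have *: "Z \<subseteq> B \<and> B - Z = N \<longleftrightarrow> Z = B - N" if "N \<subseteq> B" for N
      using that by blast
    have "{\<phi> \<in> B. \<forall>F\<in>P. F \<phi> = 0} = B - {\<phi> \<in> B. \<exists>F\<in>P. F \<phi> \<noteq> 0}"
      "{\<phi> \<in> B. \<exists>F\<in>P. F \<phi> \<noteq> 0} \<subseteq> B" by auto
    then show ?thesis by (simp only: *)
  qed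
  note * = this
  show ?thesis
    unfolding closedin_def topspace_Aut_zariski openin_Aut_zariski_iff *[symmetric]
    by (rule iffI; elim exE conjE; intro exI conjI; assumption)
qed

text \<open>
  Over a field of characteristic zero the \<open>k\<close>-points of a connected linear algebraic group are
  Zariski dense in it, hence the connected component taken here among the \<open>k\<close>-points
  is the set of \<open>k\<close>-points of the identity component, also when \<open>k\<close> is not
  algebraically closed.
\<close>

definition Aut_identity_component ::
    "('a, 'm) ring_scheme \<Rightarrow> ('k::field \<Rightarrow> 'a) \<Rightarrow> ('a \<Rightarrow> 'a) set" where
  "Aut_identity_component A \<eta> =
     connected_component_of_set (Aut_zariski A \<eta>) \<one>\<^bsub>alg_AutoGroup A \<eta>\<^esub>"


section \<open>Derivations\<close>

definition alg_derivations ::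
    "('a, 'm) ring_scheme \<Rightarrow> ('k \<Rightarrow> 'a) \<Rightarrow> ('a \<Rightarrow> 'a) set" where
  "alg_derivations A \<eta> =
     {D \<in> carrier A \<rightarrow> carrier A.
        (\<forall>a\<in>carrier A. \<forall>b\<in>carrier A. D (a \<oplus>\<^bsub>A\<^esub> b) = D a \<oplus>\<^bsub>A\<^esub> D b) \<and>
        (\<forall>c. \<forall>a\<in>carrier A. D (\<eta> c \<otimes>\<^bsub>A\<^esub> a) = \<eta> c \<otimes>\<^bsub>A\<^esub> D a) \<and>
        (\<forall>a\<in>carrier A. \<forall>b\<in>carrier A.
           D (a \<otimes>\<^bsub>A\<^esub> b) = (D a \<otimes>\<^bsub>A\<^esub> b) \<oplus>\<^bsub>A\<^esub> (a \<otimes>\<^bsub>A\<^esub> D b))}"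

definition nilpotent_on :: "('a, 'm) ring_scheme \<Rightarrow> ('a \<Rightarrow> 'a) \<Rightarrow> bool" where
  "nilpotent_on A D \<longleftrightarrow> (\<exists>N. \<forall>a\<in>carrier A. (D ^^ N) a = \<zero>\<^bsub>A\<^esub>)"


section \<open>Monomial ideals in k[S]\<close>

text \<open>
  \<open>S = (nat ^ 'n)\<close>, \<open>M = (int ^ 'n)\<close>, and \<open>k[S]\<close> is the monoid algebra
  \<open>(nat ^ 'n) \<Rightarrow>\<^sub>0 'k\<close> with convolution product; \<open>e\<^sub>i\<close> is \<open>axis i 1\<close>.
\<close>

type_synonym ('n, 'k) kS = "(nat ^ 'n) \<Rightarrow>\<^sub>0 'k"

abbreviation kS_ring :: "('n::finite, 'k::field) kS ring" where
  "kS_ring \<equiv> ring_of_type_algebra"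

definition X_pow :: "nat ^ 'n \<Rightarrow> ('n::finite, 'k::field) kS" where
  "X_pow m = Poly_Mapping.single m 1"

definition scalar :: "'k::field \<Rightarrow> ('n::finite, 'k) kS" where
  "scalar c = Poly_Mapping.single 0 c"

definition monomial_ideal :: "('n::finite, 'k::field) kS set \<Rightarrow> bool" where
  "monomial_ideal I \<longleftrightarrow> (\<exists>F. finite F \<and> I = Idl\<^bsub>kS_ring\<^esub> (X_pow ` F))"

definition supp :: "('n::finite, 'k::field) kS set \<Rightarrow> (nat ^ 'n) set" where
  "supp I = {m. X_pow m \<in> I}"

definition cofinite_support :: "('n::finite, 'k::field) kS set \<Rightarrow> bool" where
  "cofinite_support I \<longleftrightarrow> finite (UNIV - supp I)"

definition full :: "('n::finite, 'k::field) kS set \<Rightarrow> bool" where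
  "full I \<longleftrightarrow> (\<forall>i. axis i 1 \<notin> supp I)"

abbreviation quot_ring ::
    "('n::finite, 'k::field) kS set \<Rightarrow> ('n, 'k) kS set ring" where
  "quot_ring I \<equiv> kS_ring Quot I"

definition residue_class ::
    "('n::finite, 'k::field) kS set \<Rightarrow> ('n, 'k) kS \<Rightarrow> ('n, 'k) kS set" where
  "residue_class I f = I +>\<^bsub>kS_ring\<^esub> f"

abbreviation quot_scalar ::
    "('n::finite, 'k::field) kS set \<Rightarrow> 'k \<Rightarrow> ('n, 'k) kS set" where
  "quot_scalar I \<equiv> \<lambda>c. residue_class I (scalar c)"

abbreviation Aut_quot ::
    "('n::finite, 'k::field) kS set \<Rightarrow> (('n, 'k) kS set \<Rightarrow> ('n, 'k) kS set) set" where
  "Aut_quot I \<equiv> alg_automorphisms (quot_ring I) (quot_scalar I)"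

abbreviation Aut0_quot ::
    "('n::finite, 'k::field) kS set \<Rightarrow> (('n, 'k) kS set \<Rightarrow> ('n, 'k) kS set) set" where
  "Aut0_quot I \<equiv> Aut_identity_component (quot_ring I) (quot_scalar I)"


section \<open>Toric automorphisms\<close>

definition semigroup_automorphism :: "('s::plus \<Rightarrow> 's) \<Rightarrow> bool" where
  "semigroup_automorphism g \<longleftrightarrow> bij g \<and> (\<forall>a b. g (a + b) = g a + g b)"

definition induces_toric_automorphism ::
    "('n::finite, 'k::field) kS set \<Rightarrow> (nat ^ 'n \<Rightarrow> nat ^ 'n) \<Rightarrow>
     (('n, 'k) kS set \<Rightarrow> ('n, 'k) kS set) \<Rightarrow> bool" where
  "induces_toric_automorphism I g \<tau> \<longleftrightarrow>
     semigroup_automorphism g \<and> g ` supp I = supp I \<and> \<tau> \<in> Aut_quot I \<and>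
     (\<forall>m. \<tau> (residue_class I (X_pow m)) = residue_class I (X_pow (g m)))"


section \<open>The set R(S,I)\<close>

definition lattice_point :: "nat ^ 'n \<Rightarrow> int ^ 'n" where
  "lattice_point m = (\<chi> i. int (m $ i))"

text \<open>The graded piece is zero if \<open>\<beta>\<close> has a negative entry.\<close>

definition graded_piece ::
    "('n::finite, 'k::field) kS set \<Rightarrow> int ^ 'n \<Rightarrow> ('n, 'k) kS set set" where
  "graded_piece I \<beta> =
     residue_class I ` {f. \<forall>m \<in> Poly_Mapping.keys f. lattice_point m = \<beta>}"

definition homogeneous_of_degree ::
    "('n::finite, 'k::field) kS set \<Rightarrow> int ^ 'n \<Rightarrow>
     (('n, 'k) kS set \<Rightarrow> ('n, 'k) kS set) \<Rightarrow> bool" where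
  "homogeneous_of_degree I \<alpha> D \<longleftrightarrow> (\<forall>\<beta>. D ` graded_piece I \<beta> \<subseteq> graded_piece I (\<beta> + \<alpha>))"

definition liftable ::
    "('n::finite, 'k::field) kS set \<Rightarrow> (('n, 'k) kS set \<Rightarrow> ('n, 'k) kS set) \<Rightarrow> bool" where
  "liftable I D \<longleftrightarrow>
     (\<exists>\<delta> \<in> alg_derivations kS_ring scalar. \<delta> ` I \<subseteq> I \<and>
        (\<forall>f. D (residue_class I f) = residue_class I (\<delta> f)))"

definition root_set :: "('n::finite, 'k::field) kS set \<Rightarrow> (int ^ 'n) set" where
  "root_set I =
     {\<alpha>. \<exists>D \<in> alg_derivations (quot_ring I) (quot_scalar I).
        (\<exists>a \<in> carrier (quot_ring I). D a \<noteq> \<zero>\<^bsub>quot_ring I\<^esub>) \<and>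
        nilpotent_on (quot_ring I) D \<and> homogeneous_of_degree I \<alpha> D \<and> liftable I D}"

end

theory Submission
  imports Defs
begin

text \<open>
  Write \<open>A\<close> for \<open>k[S]/I\<close> and \<open>x\<^sub>a\<close> for the variables.  Both sides of the equivalence are
  compared with a combinatorial condition on the support of \<open>I\<close>: \<open>exchange a b\<close> says that
  replacing one factor \<open>x\<^sub>b\<close> of a monomial of \<open>I\<close> by \<open>x\<^sub>a\<close> stays in \<open>I\<close>, that is, the
  derivation \<open>x\<^sub>a \<partial>/\<partial>x\<^sub>b\<close> preserves \<open>I\<close>.  This relation is a preorder.

  For \<open>a \<noteq> b\<close>, \<open>e\<^sub>a - e\<^sub>b\<close> is a root if and only if \<open>exchange a b\<close>: the derivation
  \<open>x\<^sub>a \<partial>/\<partial>x\<^sub>b\<close> is a witness, and conversely a derivation of this degree sends \<open>x\<^sub>b\<close> to a non-zero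
  multiple of \<open>x\<^sub>a\<close>.  The exchange then follows from \<open>derivation_mod_exchange\<close>: if some derivation
  modulo \<open>I\<close>, homogeneous or not, has a non-zero \<open>x\<^sub>a\<close>-coefficient at \<open>x\<^sub>b\<close>, then
  \<open>exchange a b\<close>.

  To pass from the identity component to roots, let \<open>L\<close> be the linear part of an automorphism \<open>\<phi>\<close>, i.e.
  the matrix of \<open>\<phi>\<close> on the cotangent space spanned by the variables.  Conjugating the Euler
  derivation \<open>x\<^sub>c \<partial>/\<partial>x\<^sub>c\<close> by \<open>\<phi>\<close> gives a derivation with matrix entries \<open>(L\<inverse>)\<^sub>b\<^sub>c L\<^sub>c\<^sub>d\<close>, so each
  non-zero product of this form forces \<open>exchange b d\<close>.  Hence if \<open>U\<close> is a set of indices closed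
  under exchange, \<open>L\<close> maps the coordinate subspace of \<open>U\<close> onto a coordinate subspace, of a set
  \<open>C\<close> with \<open>|C| = |U|\<close> (\<open>card_column_support\<close>).  Only finitely many \<open>C\<close> can occur and each case
  is a closed condition on \<open>\<phi>\<close>, so the automorphism group is a finite disjoint union of
  closed sets indexed by \<open>C\<close>; the one with \<open>C = U\<close> is open and closed and contains the identity.
  Taking for \<open>U\<close> the indices \<open>a\<close> with \<open>exchange a j\<close>, an element of the identity component that sends
  \<open>x\<^sub>j\<close> to \<open>x\<^sub>i\<close> yields \<open>exchange i j\<close>, and symmetrically \<open>exchange j i\<close>.

  Conversely, if both exchanges hold, every linear substitution in
  \<open>x\<^sub>i, x\<^sub>j\<close> preserves \<open>I\<close>.  In the basis \<open>x\<^sub>i + x\<^sub>j\<close>, \<open>x\<^sub>i - x\<^sub>j\<close> the swap is diagonal with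
  entries \<open>1\<close> and \<open>-1\<close>, so it is the value at \<open>s = -1\<close> of the one-parameter group that fixes
  the first vector and multiplies the second one by \<open>s \<noteq> 0\<close>, whose value at \<open>s = 1\<close> is the identity.  Polynomial
  functions restrict to polynomials in \<open>s\<close> on this curve, and a non-zero polynomial has finitely many
  roots in an infinite field, so the curve is connected.
\<close>

section \<open>Polynomials as combinations of monomials\<close>

abbreviation coef :: "('n::finite, 'k::field) kS \<Rightarrow> nat ^ 'n \<Rightarrow> 'k" where
  "coef \<equiv> Poly_Mapping.lookup"

abbreviation e :: "'n::finite \<Rightarrow> nat ^ 'n" where
  "e a \<equiv> axis a 1"

abbreviation x :: "'n::finite \<Rightarrow> ('n, 'k::field) kS" where
  "x a \<equiv> X_pow (e a)"

text \<open>Otherwise \<open>axis a 1\<close> is rewritten to \<open>axis a (Suc 0)\<close>.\<close>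

declare One_nat_def [simp del]

lemma axis_nth: "axis a c $ b = (if b = a then c else 0)"
  by (simp add: axis_def)

lemma X_pow_add: "X_pow (m + m') = X_pow m * X_pow m'"
  by (simp add: X_pow_def mult_single)

lemma X_pow_0: "X_pow 0 = 1"
  by (simp add: X_pow_def)

lemma scalar_mult_X_pow: "scalar c * X_pow m = Poly_Mapping.single m c"
  by (simp add: X_pow_def scalar_def mult_single)

lemma scalar_add: "scalar (c + d) = scalar c + scalar d"
  and scalar_mult: "scalar (c * d) = scalar c * scalar d"
  and scalar_0: "scalar 0 = 0"
  and scalar_1: "scalar 1 = 1"
  by (simp_all add: scalar_def single_add mult_single)

lemma scalar_of_nat: "scalar (of_nat r) = of_nat r"
  by (simp add: scalar_def)

lemma coef_X_pow: "coef (X_pow m) m' = (if m = m' then 1 else 0)"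
  by (simp add: X_pow_def lookup_single)

lemma coef_scalar_mult: "coef (scalar c * f) m = c * coef f m"
proof -
  have "scalar c * f = Poly_Mapping.map ((*) c) f"
    by (simp add: scalar_def mult_map_scale_conv_mult)
  then show ?thesis by (simp add: Poly_Mapping.map.rep_eq when_def)
qed

lemma kS_monomial_sum:
  "f = (\<Sum>m\<in>Poly_Mapping.keys f. scalar (coef f m) * X_pow m)"
proof (rule poly_mapping_eqI)
  fix k
  have "coef (\<Sum>m\<in>Poly_Mapping.keys f. scalar (coef f m) * X_pow m) k
      = (\<Sum>m\<in>Poly_Mapping.keys f. if m = k then coef f m else 0)"
    unfolding lookup_sum by (rule sum.cong) (auto simp: coef_scalar_mult coef_X_pow)
  also have "\<dots> = coef f k"
    by (simp add: sum.delta' in_keys_iff)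
  finally show "coef f k = coef (\<Sum>m\<in>Poly_Mapping.keys f. scalar (coef f m) * X_pow m) k" ..
qed

lemma kS_monomial_induct [case_names monomial add]:
  assumes "\<And>c m. P (scalar c * X_pow m)"
    and "\<And>f g. P f \<Longrightarrow> P g \<Longrightarrow> P (f + g)"
  shows "P f"
proof -
  have zero: "P 0" using assms(1)[of 0] by (simp add: scalar_0)
  have "P (\<Sum>m\<in>K. scalar (coef f m) * X_pow m)" if "finite K" for K
    using that by induction (auto intro: zero assms)
  then show ?thesis by (subst kS_monomial_sum) simp
qed

lemma exponent_induct [case_names zero step]:
  fixes m :: "nat ^ 'n::finite"
  assumes "P 0" and "\<And>a m. P m \<Longrightarrow> P (e a + m)"
  shows "P m"
proof (induction "\<Sum>a\<in>UNIV. m $ a" arbitrary: m)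
  case 0
  then have "m = 0" by (simp add: vec_eq_iff)
  then show ?case using assms(1) by simp
next
  case (Suc s)
  then have "\<exists>a. m $ a \<noteq> 0"
    by (metis (no_types, lifting) Zero_not_Suc sum.neutral)
  then obtain a where a: "m $ a \<noteq> 0" ..
  have m: "m = e a + (m - e a)"
    using a by (auto simp: vec_eq_iff axis_nth)
  have "(\<Sum>b\<in>UNIV. m $ b) = (\<Sum>b\<in>UNIV. (if b = a then 1 else 0) + (m - e a) $ b)"
    by (subst m) (simp add: axis_nth)
  also have "\<dots> = 1 + (\<Sum>b\<in>UNIV. (m - e a) $ b)"
    by (simp add: sum.distrib)
  finally have "s = (\<Sum>b\<in>UNIV. (m - e a) $ b)" using Suc(2) by simp
  then have "P (m - e a)" by (rule Suc(1))
  then show ?case by (subst m) (rule assms(2))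
qed

text \<open>
  As a \<open>k\<close>-algebra, \<open>k[S]\<close> is generated by the variables; this reduces the comparison of
  homomorphisms, and the vanishing of derivations, to the variables.
\<close>

lemma kS_algebra_induct [case_names scalar var add mult]:
  assumes "\<And>c. P (scalar c)" and "\<And>a. P (x a)"
    and add: "\<And>f g. P f \<Longrightarrow> P g \<Longrightarrow> P (f + g)"
    and mult: "\<And>f g. P f \<Longrightarrow> P g \<Longrightarrow> P (f * g)"
  shows "P f"
proof (induction f rule: kS_monomial_induct)
  case (monomial c m)
  have "P (X_pow m)"
  proof (induction m rule: exponent_induct)
    case zero
    then show ?case using assms(1)[of 1] by (simp add: X_pow_0 scalar_1)
  next
    case (step a m)
    then show ?case by (simp add: X_pow_add assms)
  qed
  then show ?case by (simp add: assms)
qed (rule add)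

lemma coef_X_pow_mult: "coef (X_pow m * f) (m + m') = coef f m'"
proof (induction f rule: kS_monomial_induct)
  case (monomial c l)
  have "X_pow m * (scalar c * X_pow l) = scalar c * X_pow (m + l)"
    by (simp add: X_pow_add mult_ac)
  then show ?case by (simp add: coef_scalar_mult coef_X_pow)
qed (simp add: distrib_left lookup_add)

lemma coef_X_pow_mult_eq_0:
  assumes "\<And>l. m' \<noteq> m + l"
  shows "coef (X_pow m * f) m' = 0"
proof (induction f rule: kS_monomial_induct)
  case (monomial c l)
  have "X_pow m * (scalar c * X_pow l) = scalar c * X_pow (m + l)"
    by (simp add: X_pow_add mult_ac)
  then show ?case using assms[of l] by (auto simp add: coef_scalar_mult coef_X_pow)
qed (simp add: distrib_left lookup_add)

lemma exponent_minus_add: "m $ a > 0 \<Longrightarrow> m - e a + e a = m"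
  by (auto simp: vec_eq_iff axis_nth)

lemma coef_var_mult: "coef (x a * f) m = (if m $ a = 0 then 0 else coef f (m - e a))"
proof (cases "m $ a = 0")
  case True
  have "m \<noteq> e a + l" for l
    using True by (auto simp: vec_eq_iff axis_nth intro!: exI[of _ a])
  then show ?thesis using True by (simp add: coef_X_pow_mult_eq_0)
next
  case False
  then show ?thesis
    using coef_X_pow_mult[of "e a" f "m - e a"] exponent_minus_add[of m a]
    by (simp add: add.commute)
qed

lemma axis_eq_sum: "e b = m + l \<longleftrightarrow> (m = 0 \<and> l = e b) \<or> (m = e b \<and> l = 0)"
proof
  assume *: "e b = m + l"
  then have A: "m $ a + l $ a = (if a = b then 1 else 0)" for a
    by (metis axis_nth vector_add_component)
  show "(m = 0 \<and> l = e b) \<or> (m = e b \<and> l = 0)"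
  proof (cases "m $ b = 0")
    case True
    have "m $ a = 0" "l $ a = e b $ a" for a
      using A[of a] True by (auto simp: axis_nth split: if_splits)
    then show ?thesis by (simp add: vec_eq_iff)
  next
    case False
    have "m $ a = e b $ a" "l $ a = 0" for a
      using A[of a] A[of b] False by (auto simp: axis_nth split: if_splits)
    then show ?thesis by (simp add: vec_eq_iff)
  qed
qed auto

lemma coef_mult_0: "coef (f * g) 0 = coef f 0 * coef g 0"
proof (induction f rule: kS_monomial_induct)
  case (monomial c m)
  have "coef (X_pow m * g) 0 = (if m = 0 then coef g 0 else 0)"
  proof (cases "m = 0")
    case False
    then have "0 \<noteq> m + l" for l by (auto simp: vec_eq_iff)
    with False show ?thesis by (simp add: coef_X_pow_mult_eq_0)
  qed (simp add: X_pow_0)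
  then show ?case by (simp add: coef_scalar_mult coef_X_pow mult.assoc)
qed (simp add: distrib_right lookup_add)

text \<open>
  An exponent \<open>e b\<close> splits only as \<open>0 + e b\<close> or \<open>e b + 0\<close>.  In particular a product of two
  polynomials without constant term has no linear term.
\<close>

lemma coef_mult_axis:
  "coef (f * g) (e b) = coef f 0 * coef g (e b) + coef f (e b) * coef g 0"
proof (induction f rule: kS_monomial_induct)
  case (monomial c m)
  have ne: "0 \<noteq> e b" by (auto simp: vec_eq_iff axis_nth intro!: exI[of _ b])
  consider "m = 0" | "m = e b" | "m \<noteq> 0" "m \<noteq> e b" by blast
  then have "coef (X_pow m * g) (e b)
      = coef (X_pow m) 0 * coef g (e b) + coef (X_pow m) (e b) * coef g 0"
  proof cases
    case 1
    then show ?thesis using ne by (simp add: X_pow_0 lookup_one)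
  next
    case 2
    then show ?thesis using ne coef_X_pow_mult[of m g 0] by (simp add: coef_X_pow)
  next
    case 3
    then have "coef (X_pow m * g) (e b) = 0"
      by (intro coef_X_pow_mult_eq_0) (auto simp: axis_eq_sum)
    with 3 show ?thesis by (simp add: coef_X_pow)
  qed
  then show ?case by (simp add: coef_scalar_mult mult.assoc distrib_left)
qed (simp add: distrib_right lookup_add)

lemma X_pow_axis:
  fixes a :: "'n::finite"
  shows "X_pow (axis a r) = (x a ^ r :: ('n, 'k::field) kS)"
proof (induction r)
  case 0
  have "axis a 0 = (0 :: nat ^ 'n)" by (simp add: vec_eq_iff axis_nth)
  then show ?case by (simp only: X_pow_0 power_0)
next
  case (Suc r)
  have "axis a (Suc r) = e a + axis a r" by (simp add: vec_eq_iff axis_nth)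
  with Suc show ?case by (simp add: X_pow_add)
qed

text \<open>
  The partial derivative, given coefficientwise: \<open>map_key\<close> lowers the \<open>b\<close>-th exponent by one
  (dropping monomials without \<open>x b\<close>), and \<open>mapp\<close> multiplies by the old exponent.
\<close>

definition ddx :: "'n \<Rightarrow> ('n::finite, 'k::field) kS \<Rightarrow> ('n, 'k) kS" where
  "ddx b f = Poly_Mapping.mapp (\<lambda>m c. of_nat (m $ b + 1) * c)
     (Poly_Mapping.map_key (\<lambda>m. m + e b) f)"

lemma coef_ddx: "coef (ddx b f) m = of_nat (m $ b + 1) * coef f (m + e b)"
proof -
  have "coef (Poly_Mapping.map_key (\<lambda>m. m + e b) f) m = coef f (m + e b)"
    by (subst map_key.rep_eq) (auto simp: inj_on_def)
  then show ?thesis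
    by (simp add: ddx_def lookup_mapp when_def in_keys_iff)
qed

lemma ddx_add: "ddx b (f + g) = ddx b f + ddx b g"
  by (rule poly_mapping_eqI) (simp add: coef_ddx lookup_add distrib_left)

lemma ddx_scalar_mult: "ddx b (scalar c * f) = scalar c * ddx b f"
  by (rule poly_mapping_eqI) (simp add: coef_ddx coef_scalar_mult)

lemma ddx_scalar: "ddx b (scalar c) = 0"
proof (rule poly_mapping_eqI)
  fix m
  have "0 \<noteq> m + e b" by (auto simp: vec_eq_iff axis_nth intro!: exI[of _ b])
  then show "coef (ddx b (scalar c)) m = coef 0 m"
    by (simp add: coef_ddx scalar_def lookup_single)
qed

lemma ddx_X_pow: "ddx b (X_pow m) = scalar (of_nat (m $ b)) * X_pow (m - e b)"
proof (rule poly_mapping_eqI)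
  fix k
  show "coef (ddx b (X_pow m)) k = coef (scalar (of_nat (m $ b)) * X_pow (m - e b)) k"
  proof (cases "m $ b = 0")
    case True
    then have "m \<noteq> k + e b" by (auto simp: vec_eq_iff axis_nth intro!: exI[of _ b])
    with True show ?thesis by (simp add: coef_ddx coef_X_pow coef_scalar_mult)
  next
    case False
    then have "m = k + e b \<longleftrightarrow> m - e b = k"
      using exponent_minus_add[of m b] by (metis add_diff_cancel_right' gr0I)
    moreover obtain r where "m $ b = Suc r" using False by (cases "m $ b") auto
    ultimately show ?thesis by (auto simp: coef_ddx coef_X_pow coef_scalar_mult axis_nth)
  qed
qed

lemma ddx_mult: "ddx b (f * g) = ddx b f * g + f * ddx b g"
proof (induction f rule: kS_monomial_induct)
  case (monomial c m)
  show ?case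
  proof (induction g rule: kS_monomial_induct)
    case (monomial d l)
    have m: "scalar (of_nat (m $ b)) * X_pow (m + l - e b)
        = scalar (of_nat (m $ b)) * (X_pow (m - e b) * X_pow l :: ('a, 'b) kS)"
    proof (cases "m $ b = 0")
      case False
      then have "m + l - e b = (m - e b) + l" by (auto simp: vec_eq_iff axis_nth)
      then show ?thesis by (simp add: X_pow_add)
    qed (simp add: scalar_0)
    have l: "scalar (of_nat (l $ b)) * X_pow (m + l - e b)
        = scalar (of_nat (l $ b)) * (X_pow m * X_pow (l - e b) :: ('a, 'b) kS)"
    proof (cases "l $ b = 0")
      case False
      then have "m + l - e b = m + (l - e b)" by (auto simp: vec_eq_iff axis_nth)
      then show ?thesis by (simp add: X_pow_add)
    qed (simp add: scalar_0)
    have "scalar c * X_pow m * (scalar d * X_pow l) = scalar (c * d) * X_pow (m + l)"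
      by (simp add: scalar_mult X_pow_add mult_ac)
    then have "ddx b (scalar c * X_pow m * (scalar d * X_pow l))
        = scalar (c * d) * (scalar (of_nat (m $ b)) * X_pow (m + l - e b)
            + scalar (of_nat (l $ b)) * X_pow (m + l - e b))"
      by (simp add: ddx_scalar_mult ddx_X_pow scalar_add distrib_right)
    also have "\<dots> = ddx b (scalar c * X_pow m) * (scalar d * X_pow l)
        + scalar c * X_pow m * ddx b (scalar d * X_pow l)"
      unfolding m l ddx_scalar_mult ddx_X_pow scalar_mult by (simp add: algebra_simps)
    finally show ?case .
  qed (simp add: ddx_add algebra_simps)
qed (simp add: ddx_add algebra_simps)

section \<open>Monomial ideals and the quotient ring\<close>

lemma residue_class_eq: "residue_class I f = (\<lambda>h. h + f) ` I"
  by (auto simp: residue_class_def a_r_coset_def r_coset_def ring_of_type_algebra_def)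

locale monomial_quotient =
  fixes I :: "('n::finite, 'k::field_char_0) kS set"
  assumes monomial: "monomial_ideal I"
begin

abbreviation res :: "('n, 'k) kS \<Rightarrow> ('n, 'k) kS set" where
  "res \<equiv> residue_class I"

lemma ideal_I: "ideal I kS_ring"
  using monomial ring.genideal_ideal[OF ring_from_type_algebra]
  by (auto simp: monomial_ideal_def ring_of_type_algebra_def)

lemma cring_kS: "cring (kS_ring :: ('n, 'k) kS ring)"
  by (rule cring_from_type_algebra)

lemma kS_ring_sel:
  "carrier (kS_ring :: ('n, 'k) kS ring) = UNIV"
  "(f :: ('n, 'k) kS) \<oplus>\<^bsub>kS_ring\<^esub> g = f + g"
  "(f :: ('n, 'k) kS) \<otimes>\<^bsub>kS_ring\<^esub> g = f * g"
  "\<zero>\<^bsub>kS_ring\<^esub> = (0 :: ('n, 'k) kS)"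
  "\<one>\<^bsub>kS_ring\<^esub> = (1 :: ('n, 'k) kS)"
  by (simp_all add: ring_of_type_algebra_def)

lemma I_0: "0 \<in> I"
  using additive_subgroup.zero_closed[OF ideal.axioms(1)[OF ideal_I]]
  by (simp add: kS_ring_sel)

lemma I_add: "f \<in> I \<Longrightarrow> g \<in> I \<Longrightarrow> f + g \<in> I"
  using additive_subgroup.a_closed[OF ideal.axioms(1)[OF ideal_I]]
  by (simp add: kS_ring_sel)

lemma I_mult_left: "f \<in> I \<Longrightarrow> g * f \<in> I"
  using ideal.I_l_closed[OF ideal_I] by (simp add: kS_ring_sel)

lemma I_mult_right: "f \<in> I \<Longrightarrow> f * g \<in> I"
  using I_mult_left by (simp add: mult.commute)

lemma I_uminus: "f \<in> I \<Longrightarrow> - f \<in> I"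
  using I_mult_left[of f "- 1"] by simp

lemma I_diff: "f \<in> I \<Longrightarrow> g \<in> I \<Longrightarrow> f - g \<in> I"
  using I_add[of f "- g"] I_uminus by simp

lemma I_sum: "(\<And>k. k \<in> K \<Longrightarrow> f k \<in> I) \<Longrightarrow> sum f K \<in> I"
  by (induction K rule: infinite_finite_induct) (auto simp: I_0 I_add)

lemma supp_add: "m \<in> supp I \<Longrightarrow> l + m \<in> supp I"
  by (simp add: supp_def X_pow_add I_mult_left)

text \<open>
  The polynomials supported in \<open>supp I\<close> form an ideal that contains the monomial generators.
  So membership in \<open>I\<close> can be tested monomial by monomial, and coefficients outside \<open>supp I\<close>
  depend only on the residue class.
\<close>

lemma I_iff_keys: "f \<in> I \<longleftrightarrow> Poly_Mapping.keys f \<subseteq> supp I"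
proof
  assume *: "Poly_Mapping.keys f \<subseteq> supp I"
  have "(\<Sum>m\<in>Poly_Mapping.keys f. scalar (coef f m) * X_pow m) \<in> I"
    using * by (intro I_sum I_mult_left) (auto simp: supp_def)
  then show "f \<in> I" by (subst kS_monomial_sum)
next
  assume "f \<in> I"
  define J where "J = {f :: ('n, 'k) kS. Poly_Mapping.keys f \<subseteq> supp I}"
  obtain F where F: "I = Idl\<^bsub>kS_ring\<^esub> (X_pow ` F)"
    using monomial by (auto simp: monomial_ideal_def)
  have "ideal J kS_ring"
  proof (rule idealI)
    show "ring (kS_ring :: ('n, 'k) kS ring)" by (rule ring_from_type_algebra)
    interpret R: cring "kS_ring :: ('n, 'k) kS ring" by (rule cring_kS)
    have neg: "inv\<^bsub>add_monoid kS_ring\<^esub> f = - f" for f :: "('n, 'k) kS"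
      using R.minus_equality[of "- f" f] by (simp add: kS_ring_sel a_inv_def)
    show "subgroup J (add_monoid kS_ring)"
    proof (rule group.subgroupI[OF R.a_group])
      show "J \<noteq> {}" by (auto simp: J_def intro!: exI[of _ 0])
      show "f \<otimes>\<^bsub>add_monoid kS_ring\<^esub> g \<in> J" if "f \<in> J" "g \<in> J" for f g
        using that keys_add[of f g] by (auto simp: J_def kS_ring_sel)
      show "inv\<^bsub>add_monoid kS_ring\<^esub> f \<in> J" if "f \<in> J" for f
        using that unfolding neg by (auto simp: J_def in_keys_iff)
    qed (simp add: kS_ring_sel)
    have "g * f \<in> J" if "f \<in> J" for f g
      using that keys_mult[of g f] supp_add unfolding J_def by fast
    then show "\<And>a y. a \<in> J \<Longrightarrow> y \<in> carrier kS_ring \<Longrightarrow> y \<otimes>\<^bsub>kS_ring\<^esub> a \<in> J"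
      "\<And>a y. a \<in> J \<Longrightarrow> y \<in> carrier kS_ring \<Longrightarrow> a \<otimes>\<^bsub>kS_ring\<^esub> y \<in> J"
      by (simp_all add: kS_ring_sel mult.commute)
  qed
  moreover have "X_pow ` F \<subseteq> J"
  proof -
    have "X_pow m \<in> I" if "m \<in> F" for m
      using ring.genideal_self[OF ring_from_type_algebra, of "X_pow ` F"] that
      by (metis F UNIV_I image_eqI kS_ring_sel(1) subset_iff)
    then show ?thesis by (auto simp: J_def supp_def X_pow_def)
  qed
  ultimately have "I \<subseteq> J"
    unfolding F by (rule ring.genideal_minimal[OF ring_from_type_algebra])
  then show "Poly_Mapping.keys f \<subseteq> supp I" using \<open>f \<in> I\<close> by (auto simp: J_def)
qed

lemma coef_eq_0: "f \<in> I \<Longrightarrow> m \<notin> supp I \<Longrightarrow> coef f m = 0"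
  by (auto simp: I_iff_keys in_keys_iff)

lemma coef_cong: "f - g \<in> I \<Longrightarrow> m \<notin> supp I \<Longrightarrow> coef f m = coef g m"
  using coef_eq_0[of "f - g" m] by (simp add: lookup_minus)

lemma carrier_quot: "carrier (quot_ring I) = range res"
  by (auto simp: FactRing_def A_RCOSETS_def' residue_class_def kS_ring_sel)

lemma res_in_carrier: "res f \<in> carrier (quot_ring I)"
  by (simp add: carrier_quot)

lemma res_eq_iff: "res f = res g \<longleftrightarrow> f - g \<in> I"
proof
  assume "res f = res g"
  then have "f \<in> res g" using I_0 by (auto simp: residue_class_eq image_iff intro: bexI[of _ 0])
  then show "f - g \<in> I" by (auto simp: residue_class_eq)
next
  have *: "res f \<subseteq> res g" if "f - g \<in> I" for f g
  proof
    fix u assume "u \<in> res f"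
    then obtain h where "h \<in> I" "u = h + f" by (auto simp: residue_class_eq)
    with that have "h + (f - g) \<in> I" "u = (h + (f - g)) + g" by (auto intro: I_add)
    then show "u \<in> res g" unfolding residue_class_eq by blast
  qed
  assume "f - g \<in> I"
  with I_uminus[OF this] show "res f = res g" by (intro equalityI *) simp_all
qed

lemma res_mem: "f \<in> res f"
  using I_0 by (auto simp: residue_class_eq image_iff intro: bexI[of _ 0])

lemma res_mem_iff: "f \<in> res g \<longleftrightarrow> f - g \<in> I"
  by (force simp: residue_class_eq image_iff)

lemma quot_add: "res f \<oplus>\<^bsub>quot_ring I\<^esub> res g = res (f + g)"
  using abelian_subgroup.a_rcos_sum[OF ideal.axioms(1)[OF ideal_I, THEN abelian_subgroupI3], of f g]
    cring.axioms(1)[OF cring_kS]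
  by (simp add: FactRing_def residue_class_def kS_ring_sel ring_def)

lemma quot_mult: "res f \<otimes>\<^bsub>quot_ring I\<^esub> res g = res (f * g)"
  using ideal.rcoset_mult_add[OF ideal_I, of f g]
  by (simp add: FactRing_def residue_class_def kS_ring_sel)

lemma quot_one: "\<one>\<^bsub>quot_ring I\<^esub> = res 1"
  by (simp add: FactRing_def residue_class_def kS_ring_sel)

lemma quot_zero: "\<zero>\<^bsub>quot_ring I\<^esub> = res 0"
  by (simp add: FactRing_def residue_class_eq)

lemma res_eq_zero_iff: "res f = \<zero>\<^bsub>quot_ring I\<^esub> \<longleftrightarrow> f \<in> I"
  by (simp add: quot_zero res_eq_iff)

lemma res_add_cong: "res f = res f' \<Longrightarrow> res g = res g' \<Longrightarrow> res (f + g) = res (f' + g')"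
  by (simp flip: quot_add)

lemma res_mult_cong: "res f = res f' \<Longrightarrow> res g = res g' \<Longrightarrow> res (f * g) = res (f' * g')"
  by (simp flip: quot_mult)

lemma res_coef: "res f = res g \<Longrightarrow> m \<notin> supp I \<Longrightarrow> coef f m = coef g m"
  by (rule coef_cong) (simp_all add: res_eq_iff)

text \<open>
  Equivalently, \<open>x a * ddx b\<close> preserves \<open>I\<close>; the condition \<open>m $ b > 0\<close> excludes the truncated
  subtraction and accounts for the monomials that \<open>ddx b\<close> kills.
\<close>

definition exchange :: "'n \<Rightarrow> 'n \<Rightarrow> bool" where
  "exchange a b \<longleftrightarrow> (\<forall>m\<in>supp I. m $ b > 0 \<longrightarrow> m - e b + e a \<in> supp I)"

lemma exchange_refl: "exchange a a"
  by (simp add: exchange_def exponent_minus_add)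

lemma exchange_trans:
  assumes "exchange a b" and "exchange b c"
  shows "exchange a c"
  unfolding exchange_def
proof (intro ballI impI)
  fix m assume "m \<in> supp I" "m $ c > 0"
  then have "m - e c + e b \<in> supp I" using assms(2) by (auto simp: exchange_def)
  moreover have "(m - e c + e b) $ b > 0" by (simp add: axis_nth)
  ultimately have "m - e c + e b - e b + e a \<in> supp I"
    using assms(1) by (auto simp: exchange_def)
  then show "m - e c + e a \<in> supp I" by simp
qed

lemma var_ddx_in_I:
  assumes "exchange a b" and "f \<in> I"
  shows "x a * ddx b f \<in> I"
  unfolding I_iff_keys
proof
  fix m assume "m \<in> Poly_Mapping.keys (x a * ddx b f)"
  then have m: "m $ a \<noteq> 0" and "coef (ddx b f) (m - e a) \<noteq> 0"
    by (auto simp: in_keys_iff coef_var_mult split: if_splits)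
  then have "coef f (m - e a + e b) \<noteq> 0" by (simp add: coef_ddx)
  then have "m - e a + e b \<in> supp I" using assms(2) by (auto simp: I_iff_keys in_keys_iff)
  moreover have "(m - e a + e b) $ b > 0" by (simp add: axis_nth)
  ultimately have "m - e a + e b - e b + e a \<in> supp I"
    using assms(1) unfolding exchange_def by blast
  then show "m \<in> supp I" using m by (simp add: exponent_minus_add)
qed

text \<open>
  Lifts to \<open>k[S]\<close> of derivations of the quotient satisfy the Leibniz rule only modulo \<open>I\<close>.
  Working with such lifts makes it possible to conjugate derivations by lifts of automorphisms.
\<close>

definition derivation_mod :: "(('n, 'k) kS \<Rightarrow> ('n, 'k) kS) \<Rightarrow> bool" where
  "derivation_mod D \<longleftrightarrow>
     (\<forall>f g. res f = res g \<longrightarrow> res (D f) = res (D g)) \<and>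
     (\<forall>f g. res (D (f * g)) = res (D f * g + f * D g))"

lemma derivation_mod_power:
  assumes "derivation_mod D"
  shows "res (D (f ^ Suc r)) = res (of_nat (Suc r) * f ^ r * D f)"
proof (induction r)
  case (Suc r)
  have "res (D (f ^ Suc (Suc r))) = res (D f * f ^ Suc r + f * D (f ^ Suc r))"
    using assms unfolding derivation_mod_def by simp
  also have "\<dots> = res (D f * f ^ Suc r + f * (of_nat (Suc r) * f ^ r * D f))"
    by (intro res_add_cong res_mult_cong Suc refl)
  also have "D f * f ^ Suc r + f * (of_nat (Suc r) * f ^ r * D f)
      = of_nat (Suc (Suc r)) * f ^ Suc r * D f"
    by (simp add: algebra_simps)
  finally show ?case .
qed simp

text \<open>
  Write a monomial of \<open>I\<close> as \<open>x b ^ (r + 1) * y\<close> with \<open>y\<close> free of \<open>x b\<close>.  Modulo \<open>I\<close>, \<open>D\<close> sends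
  it to \<open>(r + 1) * x b ^ r * y * D (x b) + x b ^ (r + 1) * D y\<close>, which lies in \<open>I\<close>.  The
  exchanged monomial contains \<open>x b\<close> only to the power \<open>r\<close>, so the second summand does not
  contribute to it, and the first one contributes \<open>r + 1\<close> times the linear coefficient of
  \<open>D (x b)\<close>.  In characteristic zero this is non-zero.
\<close>

lemma derivation_mod_exchange:
  assumes D: "derivation_mod D" and D0: "\<And>f. f \<in> I \<Longrightarrow> D f \<in> I"
    and ab: "a \<noteq> b" and nz: "coef (D (x b)) (e a) \<noteq> 0"
  shows "exchange a b"
  unfolding exchange_def
proof (intro ballI impI)
  fix m assume m: "m \<in> supp I" "m $ b > 0"
  then obtain r where r: "m $ b = Suc r" by (cases "m $ b") auto
  define l where "l = (\<chi> c. if c = b then 0 else m $ c)"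
  have ml: "m = axis b (Suc r) + l" and mb: "m - e b = axis b r + l"
    using r by (auto simp: l_def vec_eq_iff axis_nth)
  have pow: "X_pow (axis b (Suc r)) = (x b ^ Suc r :: ('n, 'k) kS)"
    "X_pow (axis b r) = (x b ^ r :: ('n, 'k) kS)"
    by (rule X_pow_axis)+
  have "X_pow m = (x b ^ Suc r * X_pow l :: ('n, 'k) kS)"
    by (subst ml) (simp only: X_pow_add pow)
  then have "x b ^ Suc r * X_pow l \<in> I"
    using m(1) by (simp add: supp_def)
  then have "res (D (x b ^ Suc r * X_pow l)) = res 0"
    using D0 by (simp add: res_eq_iff)
  moreover have "res (D (x b ^ Suc r * X_pow l))
      = res (D (x b ^ Suc r) * X_pow l + x b ^ Suc r * D (X_pow l))"
    using D unfolding derivation_mod_def by blast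
  moreover have "\<dots> = res (of_nat (Suc r) * x b ^ r * D (x b) * X_pow l + x b ^ Suc r * D (X_pow l))"
    by (intro res_add_cong res_mult_cong derivation_mod_power D refl)
  moreover have "of_nat (Suc r) * x b ^ r * D (x b) * X_pow l + x b ^ Suc r * D (X_pow l)
      = scalar (of_nat (Suc r)) * (X_pow (m - e b) * D (x b)) + X_pow (axis b (Suc r)) * D (X_pow l)"
    by (simp only: mb X_pow_add pow scalar_of_nat mult_ac)
  ultimately have in_I: "scalar (of_nat (Suc r)) * (X_pow (m - e b) * D (x b))
      + X_pow (axis b (Suc r)) * D (X_pow l) \<in> I"
    by (metis res_eq_iff diff_zero)
  have "m - e b + e a \<noteq> axis b (Suc r) + k" for k
  proof
    assume "m - e b + e a = axis b (Suc r) + k"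
    then have "(m - e b + e a) $ b = (axis b (Suc r) + k) $ b" by simp
    then show False using ab r by (simp add: axis_nth)
  qed
  then have "coef (X_pow (axis b (Suc r)) * D (X_pow l)) (m - e b + e a) = 0"
    by (rule coef_X_pow_mult_eq_0)
  then have "coef (scalar (of_nat (Suc r)) * (X_pow (m - e b) * D (x b))
      + X_pow (axis b (Suc r)) * D (X_pow l)) (m - e b + e a)
      = of_nat (Suc r) * coef (D (x b)) (e a)"
    by (simp only: lookup_add coef_scalar_mult coef_X_pow_mult) simp
  also have "\<dots> \<noteq> 0" using nz by (simp del: of_nat_Suc)
  finally show "m - e b + e a \<in> supp I" using coef_eq_0[OF in_I] by blast
qed

end

section \<open>Roots that are differences of two basis vectors\<close>

locale full_monomial_quotient = monomial_quotient I
  for I :: "('n::finite, 'k::field_char_0) kS set" +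
  assumes full: "full I" and cofinite: "cofinite_support I"
begin

lemma axis_notin_supp: "e a \<notin> supp I"
  using full by (simp add: full_def)

lemma zero_notin_supp: "0 \<notin> supp I"
  using axis_notin_supp supp_add[of 0 "e undefined"] by auto

lemma var_notin_I: "x a \<notin> I"
  using axis_notin_supp by (simp add: supp_def)

definition induced :: "(('n, 'k) kS \<Rightarrow> ('n, 'k) kS) \<Rightarrow> ('n, 'k) kS set \<Rightarrow> ('n, 'k) kS set" where
  "induced \<delta> = (\<lambda>C\<in>carrier (quot_ring I). res (\<delta> (SOME f. f \<in> C)))"

lemma induced_res:
  assumes "\<And>f g. \<delta> (f + g) = \<delta> f + \<delta> g" and "\<And>f. f \<in> I \<Longrightarrow> \<delta> f \<in> I"
  shows "induced \<delta> (res f) = res (\<delta> f)"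
proof -
  define g where "g = (SOME g. g \<in> res f)"
  have "g \<in> res f" unfolding g_def using res_mem by (rule someI)
  then have "\<delta> (g - f) \<in> I" by (simp add: res_mem_iff assms)
  moreover have "\<delta> (g - f) = \<delta> g - \<delta> f"
    using assms(1)[of "g - f" f] by simp
  ultimately show ?thesis
    by (simp add: induced_def g_def[symmetric] res_in_carrier res_eq_iff)
qed

lemma lattice_point_inject: "lattice_point m = lattice_point l \<longleftrightarrow> m = l"
  by (simp add: lattice_point_def vec_eq_iff)

lemma lattice_point_axis: "lattice_point (e a) = axis a 1"
  by (simp add: lattice_point_def vec_eq_iff axis_nth)

text \<open>
  The witness is induced by \<open>x a * ddx b\<close>.  It is nilpotent because each application raises the
  exponent of \<open>x a\<close>, and that exponent is bounded on the finite complement of \<open>supp I\<close>; it is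
  non-zero because it maps \<open>x b\<close> to \<open>x a\<close>, which is not in \<open>I\<close> as \<open>I\<close> is full.
\<close>

lemma exchange_imp_root:
  assumes ab: "a \<noteq> b" and ex: "exchange a b"
  shows "axis a 1 - axis b 1 \<in> root_set I"
proof -
  define \<delta> :: "('n, 'k) kS \<Rightarrow> ('n, 'k) kS" where "\<delta> f = x a * ddx b f" for f
  have add: "\<delta> (f + g) = \<delta> f + \<delta> g" and scal: "\<delta> (scalar c * f) = scalar c * \<delta> f"
    and mult: "\<delta> (f * g) = \<delta> f * g + f * \<delta> g" for f g c
    by (simp_all add: \<delta>_def ddx_add ddx_scalar_mult) (simp_all add: ddx_mult algebra_simps)
  have const: "\<delta> (scalar c) = 0" for c by (simp add: \<delta>_def ddx_scalar)
  have coef: "coef (\<delta> f) m = (if m $ a = 0 then 0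
      else of_nat ((m - e a) $ b + 1) * coef f (m - e a + e b))" for f m
    by (simp add: \<delta>_def coef_var_mult coef_ddx)
  have I: "\<delta> f \<in> I" if "f \<in> I" for f
    unfolding \<delta>_def using ex that by (rule var_ddx_in_I)
  have D: "induced \<delta> (res f) = res (\<delta> f)" for f
    by (rule induced_res) (auto simp: add I)
  have "induced \<delta> \<in> alg_derivations (quot_ring I) (quot_scalar I)"
    by (auto simp: alg_derivations_def carrier_quot quot_add quot_mult D add const mult)
  moreover have "\<exists>C\<in>carrier (quot_ring I). induced \<delta> C \<noteq> \<zero>\<^bsub>quot_ring I\<^esub>"
  proof (intro bexI)
    have "\<delta> (x b) = x a"
      by (simp add: \<delta>_def ddx_X_pow axis_nth X_pow_0 scalar_1)
    then show "induced \<delta> (res (x b)) \<noteq> \<zero>\<^bsub>quot_ring I\<^esub>"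
      using var_notin_I by (simp add: D res_eq_zero_iff)
  qed (rule res_in_carrier)
  moreover have "nilpotent_on (quot_ring I) (induced \<delta>)"
  proof -
    have *: "coef ((\<delta> ^^ N) f) m = 0" if "m $ a < N" for N f m
      using that
    proof (induction N arbitrary: m)
      case (Suc N)
      show ?case
      proof (cases "m $ a = 0")
        case False
        then have "(m - e a + e b) $ a < N" using Suc(2) ab by (simp add: axis_nth)
        then have "coef ((\<delta> ^^ N) f) (m - e a + e b) = 0" by (rule Suc(1))
        then show ?thesis by (simp add: coef)
      qed (simp add: coef)
    qed simp
    have fin: "finite (UNIV - supp I)" using cofinite by (simp add: cofinite_support_def)
    define N where "N = Suc (\<Sum>m\<in>UNIV - supp I. m $ a)"
    have "m $ a < N" if "m \<notin> supp I" for m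
      using member_le_sum[of m "UNIV - supp I" "\<lambda>m. m $ a"] that fin by (simp add: N_def)
    then have "(\<delta> ^^ N) f \<in> I" for f
      unfolding I_iff_keys subset_iff in_keys_iff using * by blast
    moreover have "(induced \<delta> ^^ N) (res f) = res ((\<delta> ^^ N) f)" for f
      by (induction N) (simp_all add: D)
    ultimately show ?thesis
      unfolding nilpotent_on_def by (intro exI[of _ N]) (auto simp: carrier_quot res_eq_zero_iff)
  qed
  moreover have "homogeneous_of_degree I (axis a 1 - axis b 1) (induced \<delta>)"
    unfolding homogeneous_of_degree_def graded_piece_def
  proof (intro allI subsetI)
    fix \<beta> C
    assume "C \<in> induced \<delta> ` res ` {f. \<forall>m\<in>Poly_Mapping.keys f. lattice_point m = \<beta>}"
    then obtain f where f: "\<forall>m\<in>Poly_Mapping.keys f. lattice_point m = \<beta>" and C: "C = res (\<delta> f)"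
      by (auto simp: D)
    have "lattice_point m = \<beta> + (axis a 1 - axis b 1)" if "m \<in> Poly_Mapping.keys (\<delta> f)" for m
    proof -
      from that have m: "m $ a \<noteq> 0" and "coef f (m - e a + e b) \<noteq> 0"
        by (auto simp: in_keys_iff coef split: if_splits)
      then have "\<beta> = lattice_point (m - e a + e b)" using f by (auto simp: in_keys_iff)
      then show ?thesis using m ab
        by (auto simp: lattice_point_def vec_eq_iff axis_nth)
    qed
    then show "C \<in> res ` {f. \<forall>m\<in>Poly_Mapping.keys f. lattice_point m = \<beta> + (axis a 1 - axis b 1)}"
      unfolding C by blast
  qed
  moreover have "liftable I (induced \<delta>)"
    unfolding liftable_def
  proof (intro bexI[of _ \<delta>] conjI)
    show "\<delta> \<in> alg_derivations kS_ring scalar"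
      by (auto simp: alg_derivations_def kS_ring_sel add const mult)
  qed (auto simp: D I)
  ultimately show ?thesis unfolding root_set_def by blast
qed

text \<open>
  For \<open>l \<noteq> b\<close> the degree \<open>e l + e a - e b\<close> has a negative entry, so \<open>x l\<close> is sent to zero; the
  image of \<open>x b\<close> is a multiple of \<open>x a\<close>.  As the derivation is determined by its values on the
  variables, this multiple is not zero, and \<open>derivation_mod_exchange\<close> applies to the lift.
\<close>

lemma root_imp_exchange:
  assumes ab: "a \<noteq> b" and root: "axis a 1 - axis b 1 \<in> root_set I"
  shows "exchange a b"
proof -
  obtain D \<delta> where nz: "\<exists>C\<in>carrier (quot_ring I). D C \<noteq> \<zero>\<^bsub>quot_ring I\<^esub>"
    and hom: "homogeneous_of_degree I (axis a 1 - axis b 1) D"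
    and \<delta>: "\<delta> \<in> alg_derivations kS_ring scalar" "\<delta> ` I \<subseteq> I"
    and D: "\<And>f. D (res f) = res (\<delta> f)"
    using root by (auto simp: root_set_def liftable_def)
  have add: "\<delta> (f + g) = \<delta> f + \<delta> g" and scal: "\<delta> (scalar c * f) = scalar c * \<delta> f"
    and mult: "\<delta> (f * g) = \<delta> f * g + f * \<delta> g" for f g c
    using \<delta>(1) by (auto simp: alg_derivations_def kS_ring_sel)
  have diff: "\<delta> (f - g) = \<delta> f - \<delta> g" for f g
    using add[of "f - g" g] by simp
  have image: "\<exists>f. \<delta> (x l) - f \<in> I \<and>
      (\<forall>m\<in>Poly_Mapping.keys f. lattice_point m = axis l 1 + (axis a 1 - axis b 1))" for l
  proof -
    have "res (x l) \<in> graded_piece I (axis l 1)"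
      unfolding graded_piece_def by (rule imageI) (simp add: X_pow_def lattice_point_axis)
    then have "res (\<delta> (x l)) \<in> graded_piece I (axis l 1 + (axis a 1 - axis b 1))"
      using hom unfolding homogeneous_of_degree_def by (metis D image_subset_iff)
    then show ?thesis by (auto simp: graded_piece_def res_eq_iff)
  qed
  \<comment> \<open>the degree of the image has entry \<open>-1\<close> at \<open>b\<close>, so the graded piece is zero\<close>
  have other: "\<delta> (x l) \<in> I" if "l \<noteq> b" for l
  proof -
    obtain f where f: "\<delta> (x l) - f \<in> I"
      "\<forall>m\<in>Poly_Mapping.keys f. lattice_point m = axis l 1 + (axis a 1 - axis b 1)"
      using image by blast
    have "lattice_point m \<noteq> axis l 1 + (axis a 1 - axis b 1)" for m :: "nat ^ 'n"
    proof
      assume "lattice_point m = axis l 1 + (axis a 1 - axis b 1)"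
      then have "lattice_point m $ b = (axis l 1 + (axis a 1 - axis b 1)) $ b" by simp
      then show False using ab that by (simp add: lattice_point_def axis_nth)
    qed
    then have "Poly_Mapping.keys f = {}" using f(2) by blast
    then have "f = 0" by simp
    with f(1) show ?thesis by simp
  qed
  have "coef (\<delta> (x b)) (e a) \<noteq> 0"
  proof
    assume 0: "coef (\<delta> (x b)) (e a) = 0"
    obtain f where f: "\<delta> (x b) - f \<in> I"
      "\<forall>m\<in>Poly_Mapping.keys f. lattice_point m = axis b 1 + (axis a 1 - axis b 1)"
      using image by blast
    have "m = e a" if "m \<in> Poly_Mapping.keys f" for m
      using f(2) that lattice_point_inject[of m "e a"] by (auto simp: lattice_point_axis)
    moreover have "coef f (e a) = 0"
      using coef_cong[OF f(1) axis_notin_supp] 0 by simp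
    ultimately have "Poly_Mapping.keys f = {}" by (metis all_not_in_conv in_keys_iff)
    then have "f = 0" by simp
    with f(1) other have var: "\<delta> (x l) \<in> I" for l by (cases "l = b") auto
    have "\<delta> 1 = 0" using mult[of 1 1] by simp
    then have const: "\<delta> (scalar c) = 0" for c using scal[of c 1] by simp
    have "\<delta> f \<in> I" for f
      by (induction f rule: kS_algebra_induct)
        (auto simp: const var add mult I_0 intro!: I_add intro: I_mult_left I_mult_right)
    then show False using nz by (auto simp: carrier_quot D res_eq_zero_iff)
  qed
  moreover have "derivation_mod \<delta>"
    using \<delta>(2) diff mult by (auto simp: derivation_mod_def res_eq_iff I_0)
  ultimately show ?thesis
    using \<delta>(2) ab by (intro derivation_mod_exchange[of \<delta>]) auto
qed

end

section \<open>Linear parts of automorphisms\<close>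

context full_monomial_quotient
begin

text \<open>
  The counterpart of \<open>derivation_mod\<close> for algebra endomorphisms of the quotient: an arbitrary
  choice of representatives respects the operations only modulo \<open>I\<close>.
\<close>

definition hom_mod :: "(('n, 'k) kS \<Rightarrow> ('n, 'k) kS) \<Rightarrow> bool" where
  "hom_mod \<Phi> \<longleftrightarrow>
     (\<forall>f g. res f = res g \<longrightarrow> res (\<Phi> f) = res (\<Phi> g)) \<and>
     (\<forall>f g. res (\<Phi> (f + g)) = res (\<Phi> f + \<Phi> g)) \<and>
     (\<forall>f g. res (\<Phi> (f * g)) = res (\<Phi> f * \<Phi> g)) \<and>
     (\<forall>c. res (\<Phi> (scalar c)) = res (scalar c))"

lemma
  assumes "hom_mod \<Phi>"
  shows hom_mod_cong: "res f = res g \<Longrightarrow> res (\<Phi> f) = res (\<Phi> g)"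
    and hom_mod_add: "res (\<Phi> (f + g)) = res (\<Phi> f + \<Phi> g)"
    and hom_mod_mult: "res (\<Phi> (f * g)) = res (\<Phi> f * \<Phi> g)"
    and hom_mod_scalar: "res (\<Phi> (scalar c)) = res (scalar c)"
  using assms unfolding hom_mod_def by blast+

lemma automorphism_lift:
  assumes "\<phi> \<in> Aut_quot I"
  obtains \<Phi> \<Psi> where "hom_mod \<Phi>" "hom_mod \<Psi>" "\<And>f. \<phi> (res f) = res (\<Phi> f)"
    "\<And>f. res (\<Psi> (\<Phi> f)) = res f" "\<And>f. res (\<Phi> (\<Psi> f)) = res f"
proof -
  have hom: "\<phi> \<in> ring_hom (quot_ring I) (quot_ring I)"
    and bij: "bij_betw \<phi> (carrier (quot_ring I)) (carrier (quot_ring I))"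
    and const: "\<And>c. \<phi> (res (scalar c)) = res (scalar c)"
    using assms by (auto simp: alg_automorphisms_def Bij_def)
  have add: "\<phi> (res (f + g)) = \<phi> (res f) \<oplus>\<^bsub>quot_ring I\<^esub> \<phi> (res g)" for f g
    using ring_hom_add[OF hom res_in_carrier res_in_carrier] by (simp add: quot_add)
  have mult: "\<phi> (res (f * g)) = \<phi> (res f) \<otimes>\<^bsub>quot_ring I\<^esub> \<phi> (res g)" for f g
    using ring_hom_mult[OF hom res_in_carrier res_in_carrier] by (simp add: quot_mult)
  have "\<exists>h. \<phi> (res f) = res h" for f
    using bij_betwE[OF bij] res_in_carrier[of f] by (auto simp: carrier_quot)
  then obtain \<Phi> where \<Phi>: "\<phi> (res f) = res (\<Phi> f)" for f by metis
  have "\<exists>h. \<phi> (res h) = res f" for f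
  proof -
    have "res f \<in> \<phi> ` range res"
      using bij res_in_carrier[of f] by (simp add: bij_betw_def carrier_quot)
    then show ?thesis by auto
  qed
  then obtain \<Psi> where \<Psi>: "\<phi> (res (\<Psi> f)) = res f" for f by metis
  have inj: "res f = res g" if "\<phi> (res f) = \<phi> (res g)" for f g
    using bij that res_in_carrier by (auto simp: bij_betw_def inj_on_def)
  have "hom_mod \<Phi>"
    unfolding hom_mod_def by (auto simp flip: \<Phi> quot_add quot_mult) (auto simp: add mult const quot_add quot_mult)
  moreover have "hom_mod \<Psi>"
    unfolding hom_mod_def
  proof (intro conjI allI impI; rule inj)
    show "\<phi> (res (\<Psi> f)) = \<phi> (res (\<Psi> g))" if "res f = res g" for f g
      using that by (simp add: \<Psi>)
    show "\<phi> (res (\<Psi> (f + g))) = \<phi> (res (\<Psi> f + \<Psi> g))" for f g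
      by (simp add: add \<Psi> quot_add)
    show "\<phi> (res (\<Psi> (f * g))) = \<phi> (res (\<Psi> f * \<Psi> g))" for f g
      by (simp add: mult \<Psi> quot_mult)
    show "\<phi> (res (\<Psi> (scalar c))) = \<phi> (res (scalar c))" for c
      by (simp add: \<Psi> const)
  qed
  moreover have "res (\<Phi> (\<Psi> f)) = res f" for f by (simp flip: \<Phi> add: \<Psi>)
  moreover have "res (\<Psi> (\<Phi> f)) = res f" for f by (rule inj) (metis \<Phi> \<Psi>)
  ultimately show ?thesis using that \<Phi> by blast
qed

text \<open>
  The powers of a monomial other than \<open>1\<close> are distinct monomials, and only finitely many
  monomials lie outside \<open>I\<close>.
\<close>

lemma power_X_pow_in_I:
  assumes "m \<noteq> 0"
  shows "\<exists>N. X_pow m ^ N \<in> I"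
proof (rule ccontr)
  assume none: "\<nexists>N. X_pow m ^ N \<in> I"
  define g where "g N = (\<chi> a. N * m $ a)" for N
  have "X_pow m ^ N = (X_pow (g N) :: ('n, 'k) kS)" for N
  proof (induction N)
    case 0
    have "g 0 = 0" by (simp add: g_def vec_eq_iff)
    then show ?case by (simp add: X_pow_0)
  next
    case (Suc N)
    have "g (Suc N) = m + g N" by (simp add: g_def vec_eq_iff)
    with Suc show ?case by (simp add: X_pow_add)
  qed
  with none have "range g \<subseteq> UNIV - supp I" by (auto simp: supp_def)
  moreover have "inj g"
    using assms by (auto simp: g_def inj_def vec_eq_iff)
  ultimately show False
    using cofinite finite_subset range_inj_infinite by (auto simp: cofinite_support_def)
qed

text \<open>
  Every monomial other than \<open>1\<close> is nilpotent modulo \<open>I\<close> because \<open>I\<close> has cofinite support.  So is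
  its image, whose constant term must then vanish.  Thus endomorphisms preserve the maximal
  ideal and, by \<open>coef_mult_axis\<close>, its square, and so have a well-defined linear part.
\<close>

lemma hom_mod_constant_term:
  assumes \<Phi>: "hom_mod \<Phi>" and "m \<noteq> 0"
  shows "coef (\<Phi> (X_pow m)) 0 = 0"
proof -
  obtain N where N: "X_pow m ^ N \<in> I" using power_X_pow_in_I[OF assms(2)] by blast
  have *: "res (\<Phi> (f ^ N)) = res (\<Phi> f ^ N)" for f N
  proof (induction N)
    case 0
    show ?case using hom_mod_scalar[OF \<Phi>, of 1] by (simp add: scalar_1)
  next
    case (Suc N)
    have "res (\<Phi> (f ^ Suc N)) = res (\<Phi> f * \<Phi> (f ^ N))"
      using hom_mod_mult[OF \<Phi>] by simp
    also have "\<dots> = res (\<Phi> f * \<Phi> f ^ N)" by (rule res_mult_cong[OF refl Suc])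
    finally show ?case by simp
  qed
  have "res (\<Phi> (X_pow m ^ N)) = res (\<Phi> (scalar 0))"
    using N by (intro hom_mod_cong[OF \<Phi>]) (simp add: res_eq_iff scalar_0)
  also have "\<dots> = res 0" using hom_mod_scalar[OF \<Phi>, of 0] by (simp add: scalar_0)
  finally have "coef (\<Phi> (X_pow m) ^ N) 0 = 0"
    using res_coef[OF _ zero_notin_supp] unfolding * by fastforce
  moreover have "coef (f ^ N) 0 = coef f 0 ^ N" for f :: "('n, 'k) kS"
    by (induction N) (simp_all add: coef_mult_0 lookup_one)
  ultimately show ?thesis by simp
qed

lemma coef_axis_res: "res f = res g \<Longrightarrow> coef f (e b) = coef g (e b)"
  by (rule res_coef[OF _ axis_notin_supp])

text \<open>
  Constants and products of two non-constant monomials are mapped to elements without linear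
  term, so only the linear terms of \<open>h\<close> contribute.
\<close>

lemma hom_mod_linear_part:
  assumes \<Phi>: "hom_mod \<Phi>"
  shows "coef (\<Phi> h) (e b) = (\<Sum>c\<in>UNIV. coef h (e c) * coef (\<Phi> (x c)) (e b))"
proof (induction h rule: kS_monomial_induct)
  case (add f g)
  have "coef (\<Phi> (f + g)) (e b) = coef (\<Phi> f + \<Phi> g) (e b)"
    by (intro coef_axis_res hom_mod_add \<Phi>)
  with add show ?case by (simp add: lookup_add distrib_right sum.distrib)
next
  case (monomial d m)
  have ne: "0 \<noteq> e b" by (auto simp: vec_eq_iff axis_nth intro!: exI[of _ b])
  have const: "coef (\<Phi> (scalar d)) (e b) = 0" "coef (\<Phi> (scalar d)) 0 = d" for d
    using res_coef[OF hom_mod_scalar[OF \<Phi>, of d]] axis_notin_supp zero_notin_supp ne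
    by (auto simp: scalar_def lookup_single)
  have "coef (\<Phi> (X_pow m)) (e b) = (\<Sum>c\<in>UNIV. (if m = e c then 1 else 0) * coef (\<Phi> (x c)) (e b))"
  proof (induction m rule: exponent_induct)
    case zero
    have "0 \<noteq> e c" for c :: 'n by (auto simp: vec_eq_iff axis_nth intro!: exI[of _ c])
    then show ?case using const[of 1] by (simp add: X_pow_0 scalar_1)
  next
    case (step a m)
    have ea: "e a \<noteq> 0" by (auto simp: vec_eq_iff axis_nth intro!: exI[of _ a])
    show ?case
    proof (cases "m = 0")
      case True
      have "e a + m = e c \<longleftrightarrow> c = a" for c
        using True by (auto simp: axis_eq_axis)
      then show ?thesis using True by (simp add: if_distrib[of "\<lambda>u. u * _"] cong: if_cong)
    next
      case False
      have "coef (\<Phi> (X_pow (e a + m))) (e b) = coef (\<Phi> (x a) * \<Phi> (X_pow m)) (e b)"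
        unfolding X_pow_add by (intro coef_axis_res hom_mod_mult \<Phi>)
      also have "\<dots> = 0"
        using hom_mod_constant_term[OF \<Phi>] False ea by (simp add: coef_mult_axis)
      finally have "coef (\<Phi> (X_pow (e a + m))) (e b) = 0" .
      moreover have "e a + m \<noteq> e c" for c
        using False ea axis_eq_sum[of c "e a" m] by auto
      ultimately show ?thesis by simp
    qed
  qed
  moreover have "coef (\<Phi> (scalar d * X_pow m)) (e b) = d * coef (\<Phi> (X_pow m)) (e b)"
  proof -
    have "coef (\<Phi> (scalar d * X_pow m)) (e b) = coef (\<Phi> (scalar d) * \<Phi> (X_pow m)) (e b)"
      by (intro coef_axis_res hom_mod_mult \<Phi>)
    then show ?thesis by (simp add: coef_mult_axis const)
  qed
  ultimately show ?case
    by (simp add: coef_scalar_mult coef_X_pow sum_distrib_left mult.assoc)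
qed

lemma linear_parts_inverse:
  assumes \<Psi>: "hom_mod \<Psi>" and inv: "\<And>f. res (\<Psi> (\<Phi> f)) = res f"
  shows "(\<Sum>c\<in>UNIV. coef (\<Psi> (x c)) (e b) * coef (\<Phi> (x d)) (e c)) = (if b = d then 1 else 0)"
proof -
  have "coef (\<Psi> (\<Phi> (x d))) (e b) = coef (x d) (e b)"
    by (rule coef_axis_res[OF inv])
  then show ?thesis
    by (simp add: hom_mod_linear_part[OF \<Psi>, of "\<Phi> (x d)"] coef_X_pow axis_eq_axis mult.commute)
qed

text \<open>
  Conjugating the Euler derivation \<open>x c * ddx c\<close>, which preserves every monomial ideal, by an
  automorphism yields a derivation whose linear coefficient of index \<open>(b, d)\<close> is the product in
  the hypothesis; \<open>derivation_mod_exchange\<close> turns its non-vanishing into an exchange.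
\<close>

lemma linear_parts_exchange:
  assumes \<Phi>: "hom_mod \<Phi>" and \<Psi>: "hom_mod \<Psi>" and inv: "\<And>f. res (\<Psi> (\<Phi> f)) = res f"
    and nz: "coef (\<Psi> (x c)) (e b) * coef (\<Phi> (x d)) (e c) \<noteq> 0"
  shows "exchange b d"
proof (cases "b = d")
  case False
  define E :: "('n, 'k) kS \<Rightarrow> ('n, 'k) kS" where "E f = x c * ddx c f" for f
  define D where "D f = \<Psi> (E (\<Phi> f))" for f
  have E: "E f \<in> I" if "f \<in> I" for f
    unfolding E_def using exchange_refl that by (rule var_ddx_in_I)
  have "E (f - g) = E f - E g" for f g
    using ddx_add[of c "f - g" g] by (simp add: E_def algebra_simps)
  then have E_cong: "res (E f) = res (E g)" if "res f = res g" for f g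
    using that E[of "f - g"] by (simp add: res_eq_iff)
  have "derivation_mod D"
    unfolding derivation_mod_def
  proof (intro conjI allI impI)
    show "res (D f) = res (D g)" if "res f = res g" for f g
      unfolding D_def by (intro hom_mod_cong[OF \<Psi>] E_cong hom_mod_cong[OF \<Phi>] that)
    fix f g
    have "res (D (f * g)) = res (\<Psi> (E (\<Phi> f * \<Phi> g)))"
      unfolding D_def by (intro hom_mod_cong[OF \<Psi>] E_cong hom_mod_mult[OF \<Phi>])
    also have "E (\<Phi> f * \<Phi> g) = E (\<Phi> f) * \<Phi> g + \<Phi> f * E (\<Phi> g)"
      by (simp add: E_def ddx_mult algebra_simps)
    also have "res (\<Psi> \<dots>) = res (\<Psi> (E (\<Phi> f) * \<Phi> g) + \<Psi> (\<Phi> f * E (\<Phi> g)))"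
      by (rule hom_mod_add[OF \<Psi>])
    also have "\<dots> = res (D f * \<Psi> (\<Phi> g) + \<Psi> (\<Phi> f) * D g)"
      unfolding D_def by (intro res_add_cong hom_mod_mult[OF \<Psi>])
    also have "\<dots> = res (D f * g + f * D g)"
      by (intro res_add_cong res_mult_cong inv refl)
    finally show "res (D (f * g)) = res (D f * g + f * D g)" .
  qed
  moreover have "D f \<in> I" if "f \<in> I" for f
  proof -
    have zero: "res (\<Theta> f) = res 0" if "hom_mod \<Theta>" "res f = res 0" for \<Theta> f
      using hom_mod_cong[OF that] hom_mod_scalar[OF that(1), of 0] by (simp add: scalar_0)
    have "res (\<Phi> f) = res 0" by (rule zero[OF \<Phi>]) (simp add: res_eq_iff that)
    then have "res (E (\<Phi> f)) = res 0" using E by (simp add: res_eq_iff)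
    then have "res (D f) = res 0" unfolding D_def by (rule zero[OF \<Psi>])
    then show ?thesis by (simp add: res_eq_iff)
  qed
  moreover have "coef (D (x d)) (e b) \<noteq> 0"
  proof -
    have "coef (E f) (e c') = (if c' = c then coef f (e c) else 0)" for f c'
      by (auto simp: E_def coef_var_mult coef_ddx axis_nth)
    then have "coef (D (x d)) (e b) = coef (\<Phi> (x d)) (e c) * coef (\<Psi> (x c)) (e b)"
      by (simp add: D_def hom_mod_linear_part[OF \<Psi>, of "E (\<Phi> (x d))"] if_distrib[of "\<lambda>u. u * _"] cong: if_cong)
    then show ?thesis using nz by simp
  qed
  ultimately show ?thesis using False by (intro derivation_mod_exchange[of D])
qed (simp add: exchange_refl)

end

text \<open>
  The set on the left indexes the coordinate subspace onto which \<open>L\<close> maps the coordinate subspace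
  of \<open>U\<close>.  Both cardinalities are the trace of \<open>L P L'\<close>, where \<open>P\<close> is the coordinate projection
  onto \<open>U\<close>; characteristic zero allows to recover them from their images in the field.
\<close>

lemma card_column_support:
  fixes L L' :: "'a::finite \<Rightarrow> 'a \<Rightarrow> 'k::field_char_0"
  assumes L'L: "\<And>b d. (\<Sum>c\<in>UNIV. L' b c * L c d) = (if b = d then 1 else 0)"
    and LL': "\<And>b d. (\<Sum>c\<in>UNIV. L b c * L' c d) = (if b = d then 1 else 0)"
    and U: "\<And>b c d. d \<in> U \<Longrightarrow> L' b c * L c d \<noteq> 0 \<Longrightarrow> b \<in> U"
  shows "card {c. \<exists>d\<in>U. L c d \<noteq> 0} = card U"
proof -
  define C where "C = {c. \<exists>d\<in>U. L c d \<noteq> 0}"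
  have "(of_nat (card U) :: 'k) = (\<Sum>d\<in>U. \<Sum>c\<in>UNIV. L' d c * L c d)"
    by (simp add: L'L)
  also have "\<dots> = (\<Sum>c\<in>UNIV. \<Sum>d\<in>U. L' d c * L c d)" by (rule sum.swap)
  also have "\<dots> = (\<Sum>c\<in>C. \<Sum>d\<in>U. L' d c * L c d)"
    by (rule sum.mono_neutral_right) (auto simp: C_def)
  also have "\<dots> = (\<Sum>c\<in>C. \<Sum>d\<in>UNIV. L c d * L' d c)"
  proof (rule sum.cong[OF refl])
    fix c assume "c \<in> C"
    \<comment> \<open>the column \<open>c\<close> of \<open>L'\<close> is supported in \<open>U\<close>, so the sum extends to all \<open>d\<close>\<close>
    then have "L' d c = 0" if "d \<notin> U" for d
      using U that by (auto simp: C_def)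
    then show "(\<Sum>d\<in>U. L' d c * L c d) = (\<Sum>d\<in>UNIV. L c d * L' d c)"
      by (intro sum.mono_neutral_cong_left) (auto simp: mult.commute)
  qed
  also have "\<dots> = of_nat (card C)" by (simp add: LL')
  finally show ?thesis by (simp add: C_def)
qed

section \<open>The identity component preserves exchange-closed coordinate subspaces\<close>

context full_monomial_quotient
begin

text \<open>
  The coefficient at \<open>e c\<close> does not depend on the representative as \<open>e c\<close> is not in the support
  of a full ideal.  It is a linear functional on the quotient, so linear parts of automorphisms have
  entries that are polynomial functions.
\<close>

definition axis_coef :: "'n \<Rightarrow> ('n, 'k) kS set \<Rightarrow> 'k" where
  "axis_coef c C = coef (SOME f. f \<in> C) (e c)"

lemma axis_coef_res: "axis_coef c (res f) = coef f (e c)"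
proof -
  have "(SOME g. g \<in> res f) \<in> res f" using res_mem by (rule someI)
  then show ?thesis
    unfolding axis_coef_def by (intro coef_axis_res) (simp add: res_eq_iff res_mem_iff)
qed

lemma axis_coef_linear: "axis_coef c \<in> linear_functionals (quot_ring I) (quot_scalar I)"
  by (auto simp: linear_functionals_def carrier_quot quot_add quot_mult axis_coef_res
      lookup_add coef_scalar_mult)

definition linear_part :: "(('n, 'k) kS set \<Rightarrow> ('n, 'k) kS set) \<Rightarrow> 'n \<Rightarrow> 'n \<Rightarrow> 'k" where
  "linear_part \<phi> c d = axis_coef c (\<phi> (res (x d)))"

lemma card_linear_part_support:
  assumes "\<phi> \<in> Aut_quot I" and U: "\<And>b d. d \<in> U \<Longrightarrow> exchange b d \<Longrightarrow> b \<in> U"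
  shows "card {c. \<exists>d\<in>U. linear_part \<phi> c d \<noteq> 0} = card U"
proof -
  obtain \<Phi> \<Psi> where *: "hom_mod \<Phi>" "hom_mod \<Psi>" "\<And>f. \<phi> (res f) = res (\<Phi> f)"
    "\<And>f. res (\<Psi> (\<Phi> f)) = res f" "\<And>f. res (\<Phi> (\<Psi> f)) = res f"
    using automorphism_lift[OF assms(1)] by blast
  have L: "linear_part \<phi> = (\<lambda>c d. coef (\<Phi> (x d)) (e c))"
    by (intro ext) (simp add: linear_part_def *(3) axis_coef_res)
  show ?thesis
    unfolding L
  proof (rule card_column_support[where L' = "\<lambda>b c. coef (\<Psi> (x c)) (e b)"])
    show "b \<in> U" if "d \<in> U" "coef (\<Psi> (x c)) (e b) * coef (\<Phi> (x d)) (e c) \<noteq> 0" for b c d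
      using U linear_parts_exchange[OF *(1,2,4)] that by blast
  qed (simp_all add: linear_parts_inverse *)
qed

text \<open>
  Automorphisms whose linear part maps the coordinate subspace of \<open>U\<close> into that of \<open>C\<close>.
\<close>

definition block_zero :: "'n set \<Rightarrow> 'n set \<Rightarrow> (('n, 'k) kS set \<Rightarrow> ('n, 'k) kS set) set" where
  "block_zero U C = {\<phi> \<in> Aut_quot I. \<forall>d\<in>U. \<forall>c. c \<notin> C \<longrightarrow> linear_part \<phi> c d = 0}"

lemma closedin_block_zero:
  "closedin (Aut_zariski (quot_ring I) (quot_scalar I)) (block_zero U C)"
  unfolding closedin_Aut_zariski_iff
proof (intro exI conjI)
  let ?P = "{\<lambda>\<phi>. linear_part \<phi> c d |c d. d \<in> U \<and> c \<notin> C}"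
  show "?P \<subseteq> polynomial_functions (quot_ring I) (quot_scalar I)"
    unfolding linear_part_def
    by (auto intro!: polynomial_functions.entry axis_coef_linear res_in_carrier)
  show "block_zero U C = {\<phi> \<in> Aut_quot I. \<forall>F\<in>?P. F \<phi> = 0}"
    by (auto simp: block_zero_def)
qed

text \<open>
  For \<open>card C = card U\<close> the sets \<open>block_zero U C\<close> are closed, pairwise disjoint and cover the
  automorphism group, since the support \<open>S \<psi>\<close> of the columns in \<open>U\<close> always has cardinality
  \<open>card U\<close> and so equals any \<open>C\<close> of that cardinality that contains it.  There are finitely many of
  them, so \<open>block_zero U U\<close> is open and closed; it contains the identity.
\<close>

lemma identity_component_linear_part:
  assumes U: "\<And>b d. d \<in> U \<Longrightarrow> exchange b d \<Longrightarrow> b \<in> U"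
    and \<phi>: "\<phi> \<in> Aut0_quot I" and "d \<in> U" and nz: "linear_part \<phi> c d \<noteq> 0"
  shows "c \<in> U"
proof -
  let ?X = "Aut_zariski (quot_ring I) (quot_scalar I)"
  let ?Z = "block_zero U"
  let ?\<C> = "{C. card C = card U \<and> C \<noteq> U}"
  define S where "S \<psi> = {c. \<exists>d\<in>U. linear_part \<psi> c d \<noteq> 0}" for \<psi>
  have card: "card (S \<psi>) = card U" if "\<psi> \<in> Aut_quot I" for \<psi>
    unfolding S_def by (rule card_linear_part_support[OF that]) (rule U)
  have Z: "\<psi> \<in> ?Z C \<longleftrightarrow> \<psi> \<in> Aut_quot I \<and> S \<psi> = C" if "card C = card U" for \<psi> C
  proof -
    have "\<psi> \<in> ?Z C \<longleftrightarrow> \<psi> \<in> Aut_quot I \<and> S \<psi> \<subseteq> C"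
      by (auto simp: block_zero_def S_def)
    then show ?thesis
      using card[of \<psi>] that card_subset_eq[OF finite, of "S \<psi>" C] by (metis subset_refl)
  qed
  have "topspace ?X - ?Z U = (\<Union>C\<in>?\<C>. ?Z C)"
  proof (intro equalityI subsetI)
    fix \<psi> assume "\<psi> \<in> topspace ?X - ?Z U"
    then have "\<psi> \<in> Aut_quot I" "S \<psi> \<noteq> U"
      using Z[OF refl, of \<psi>] by (simp_all add: topspace_Aut_zariski)
    then have "S \<psi> \<in> ?\<C>" "\<psi> \<in> ?Z (S \<psi>)"
      using card[of \<psi>] Z[of "S \<psi>" \<psi>] by simp_all
    then show "\<psi> \<in> (\<Union>C\<in>?\<C>. ?Z C)" by blast
  next
    fix \<psi> assume "\<psi> \<in> (\<Union>C\<in>?\<C>. ?Z C)"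
    then obtain C where "card C = card U" "C \<noteq> U" "\<psi> \<in> ?Z C" by blast
    then have "\<psi> \<in> Aut_quot I" "S \<psi> \<noteq> U"
      using Z[of C \<psi>] by simp_all
    then show "\<psi> \<in> topspace ?X - ?Z U"
      using Z[OF refl, of \<psi>] by (simp add: topspace_Aut_zariski)
  qed
  moreover have "closedin ?X (\<Union>C\<in>?\<C>. ?Z C)"
    by (intro closedin_Union) (auto simp: closedin_block_zero)
  ultimately have "openin ?X (?Z U)"
    unfolding openin_closedin_eq topspace_Aut_zariski by (simp add: block_zero_def)
  moreover have "closedin ?X (?Z U)" by (rule closedin_block_zero)
  moreover obtain T where T: "connectedin ?X T" "\<one>\<^bsub>alg_AutoGroup (quot_ring I) (quot_scalar I)\<^esub> \<in> T" "\<phi> \<in> T"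
    using \<phi> by (auto simp: Aut_identity_component_def connected_component_of_def)
  moreover have "\<one>\<^bsub>alg_AutoGroup (quot_ring I) (quot_scalar I)\<^esub> \<in> ?Z U"
  proof -
    let ?id = "\<one>\<^bsub>alg_AutoGroup (quot_ring I) (quot_scalar I)\<^esub>"
    have "?id \<in> Aut_quot I"
      using T connectedin_subset_topspace topspace_Aut_zariski by blast
    moreover have "linear_part ?id c d = (if c = d then 1 else 0)" for c d
      by (simp add: alg_AutoGroup_def BijGroup_def linear_part_def res_in_carrier axis_coef_res
          coef_X_pow axis_eq_axis)
    ultimately show ?thesis by (auto simp: block_zero_def)
  qed
  ultimately have "\<phi> \<in> ?Z U"
    using connectedin_clopen_cases[of ?X T "?Z U"] by (auto simp: disjnt_def)
  then show ?thesis using \<open>d \<in> U\<close> nz by (auto simp: block_zero_def)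
qed

lemma identity_component_exchange:
  assumes "\<tau> \<in> Aut0_quot I" and "\<tau> (res (x b)) = res (x a)"
  shows "exchange a b"
proof -
  have "linear_part \<tau> a b \<noteq> 0"
    by (simp add: linear_part_def assms(2) axis_coef_res coef_X_pow)
  moreover have "c \<in> {a. exchange a b}" if "d \<in> {a. exchange a b}" "exchange c d" for c d
    using that exchange_trans[of c d b] by simp
  moreover have "b \<in> {a. exchange a b}" by (simp add: exchange_refl)
  ultimately have "a \<in> {a. exchange a b}"
    using assms(1) identity_component_linear_part[of "{a. exchange a b}" \<tau> b a] by blast
  then show ?thesis by simp
qed

end

section \<open>Substitutions\<close>

definition subst :: "('n \<Rightarrow> ('n, 'k) kS) \<Rightarrow> ('n::finite, 'k::field) kS \<Rightarrow> ('n, 'k) kS" where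
  "subst v f = (\<Sum>m\<in>Poly_Mapping.keys f. scalar (coef f m) * (\<Prod>a\<in>UNIV. v a ^ (m $ a)))"

lemma prod_power_axis:
  fixes v :: "'n::finite \<Rightarrow> 'a::comm_monoid_mult"
  shows "(\<Prod>b\<in>UNIV. v b ^ (e a $ b)) = v a"
proof -
  have "(\<Prod>b\<in>UNIV. v b ^ (e a $ b)) = (\<Prod>b\<in>UNIV. if b = a then v b else 1)"
    by (rule prod.cong) (auto simp: axis_nth)
  then show ?thesis by simp
qed

lemma prod_power_add:
  fixes v :: "'n::finite \<Rightarrow> 'a::comm_monoid_mult"
  shows "(\<Prod>b\<in>UNIV. v b ^ ((m + l) $ b)) = (\<Prod>b\<in>UNIV. v b ^ (m $ b)) * (\<Prod>b\<in>UNIV. v b ^ (l $ b))"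
  by (simp add: power_add prod.distrib)

lemma subst_superset:
  assumes "finite K" and "Poly_Mapping.keys f \<subseteq> K"
  shows "subst v f = (\<Sum>m\<in>K. scalar (coef f m) * (\<Prod>a\<in>UNIV. v a ^ (m $ a)))"
  unfolding subst_def using assms
  by (intro sum.mono_neutral_left) (auto simp: in_keys_iff scalar_0)

lemma subst_add: "subst v (f + g) = subst v f + subst v g"
proof -
  let ?K = "Poly_Mapping.keys f \<union> Poly_Mapping.keys g"
  have "Poly_Mapping.keys (f + g) \<subseteq> ?K" by (rule keys_add)
  then show ?thesis
    by (simp add: subst_superset[of ?K] lookup_add scalar_add distrib_right sum.distrib)
qed

lemma subst_monomial:
  "subst v (scalar c * X_pow m) = scalar c * (\<Prod>a\<in>UNIV. v a ^ (m $ a))"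
  unfolding scalar_mult_X_pow
  by (subst subst_superset[of "{m}"]) auto

lemma subst_scalar: "subst v (scalar c) = scalar c"
  using subst_monomial[of v c 0] by (simp add: X_pow_0)

lemma subst_var: "subst v (x a) = v a"
  using subst_monomial[of v 1 "e a"] by (simp add: scalar_1 prod_power_axis)

lemma subst_mult: "subst v (f * g) = subst v f * subst v g"
proof (induction f rule: kS_monomial_induct)
  case (monomial c m)
  show ?case
  proof (induction g rule: kS_monomial_induct)
    case (monomial d l)
    have "scalar c * X_pow m * (scalar d * X_pow l) = scalar (c * d) * X_pow (m + l)"
      by (simp add: scalar_mult X_pow_add mult_ac)
    then have "subst v (scalar c * X_pow m * (scalar d * X_pow l))
        = scalar (c * d) * (\<Prod>a\<in>UNIV. v a ^ ((m + l) $ a))"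
      by (simp only: subst_monomial)
    also have "\<dots> = subst v (scalar c * X_pow m) * subst v (scalar d * X_pow l)"
      unfolding subst_monomial by (simp only: prod_power_add scalar_mult mult_ac)
    finally show ?case .
  qed (simp add: subst_add algebra_simps)
qed (simp add: subst_add algebra_simps)

lemma subst_diff: "subst v (f - g) = subst v f - subst v g"
  using subst_add[of v "f - g" g] by simp

lemma subst_polynomial:
  fixes V :: "'n::finite \<Rightarrow> ('n, 'k::field) kS poly"
  shows "\<exists>Q. \<forall>s. subst (\<lambda>a. poly (V a) (scalar s)) f = poly Q (scalar s)"
proof (intro exI allI)
  fix s
  show "subst (\<lambda>a. poly (V a) (scalar s)) f
      = poly (\<Sum>m\<in>Poly_Mapping.keys f. [:scalar (coef f m):] * (\<Prod>a\<in>UNIV. V a ^ (m $ a))) (scalar s)"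
    by (simp add: subst_def poly_sum poly_prod poly_power)
qed

section \<open>The reflection torus\<close>

context full_monomial_quotient
begin

text \<open>
  The factors \<open>v a\<close> replace those of a monomial of \<open>I\<close> one at a time: the hypothesis holds
  for linear combinations \<open>v a\<close> of variables \<open>x b\<close> with \<open>exchange b a\<close>, and each exchange stays in
  \<open>I\<close>.  The exponent \<open>m\<close> records the factors still to be replaced, and \<open>l\<close> the variables chosen so far.
\<close>

lemma prod_power_in_I:
  assumes v: "\<And>a f. (\<And>b. exchange b a \<Longrightarrow> x b * f \<in> I) \<Longrightarrow> v a * f \<in> I"
  shows "m + l \<in> supp I \<Longrightarrow> (\<Prod>a\<in>UNIV. v a ^ (m $ a)) * X_pow l \<in> I"
proof (induction m arbitrary: l rule: exponent_induct)
  case zero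
  then show ?case by (simp add: supp_def)
next
  case (step a m)
  have "x b * ((\<Prod>a\<in>UNIV. v a ^ (m $ a)) * X_pow l) \<in> I" if "exchange b a" for b
  proof -
    have "(e a + m + l) $ a > 0" by (simp add: axis_nth)
    then have "e a + m + l - e a + e b \<in> supp I"
      using that step(2) unfolding exchange_def by blast
    moreover have "e a + m + l - e a + e b = m + (e b + l)"
      by (simp add: vec_eq_iff)
    ultimately have "(\<Prod>a\<in>UNIV. v a ^ (m $ a)) * X_pow (e b + l) \<in> I"
      using step(1) by simp
    then show ?thesis by (simp add: X_pow_add mult_ac)
  qed
  then have "v a * ((\<Prod>a\<in>UNIV. v a ^ (m $ a)) * X_pow l) \<in> I" by (rule v)
  then show ?case unfolding prod_power_add prod_power_axis by (simp only: mult.assoc)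
qed

lemma subst_in_I:
  assumes "\<And>a f. (\<And>b. exchange b a \<Longrightarrow> x b * f \<in> I) \<Longrightarrow> v a * f \<in> I" and "f \<in> I"
  shows "subst v f \<in> I"
  unfolding subst_def
proof (intro I_sum I_mult_left)
  fix m assume "m \<in> Poly_Mapping.keys f"
  then have "m + 0 \<in> supp I" using assms(2) by (auto simp: I_iff_keys)
  then have "(\<Prod>a\<in>UNIV. v a ^ (m $ a)) * X_pow 0 \<in> I"
    by (rule prod_power_in_I[rotated]) (rule assms(1))
  then show "(\<Prod>a\<in>UNIV. v a ^ (m $ a)) \<in> I" by (simp add: X_pow_0)
qed

text \<open>
  Here \<open>Q\<close> is a polynomial over \<open>k[S]\<close>, i.e. a polynomial curve in \<open>k[S]\<close> with parameter \<open>s\<close>.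
\<close>

lemma functional_of_polynomial:
  fixes Q :: "('n, 'k) kS poly"
  assumes l: "l \<in> linear_functionals (quot_ring I) (quot_scalar I)"
  shows "\<exists>q. \<forall>s. l (res (poly Q (scalar s))) = poly q s"
proof (induction Q)
  case 0
  have "l (res (0 + 0)) = l (res 0) + l (res 0)"
    using l unfolding linear_functionals_def quot_add[symmetric] by (auto simp: res_in_carrier)
  then show ?case by (intro exI[of _ 0]) simp
next
  case (pCons f Q)
  then obtain q where q: "\<And>s. l (res (poly Q (scalar s))) = poly q s" by blast
  have "l (res (scalar c * h)) = c * l (res h)" for h c
    using l unfolding linear_functionals_def quot_mult[symmetric] by (auto simp: res_in_carrier)
  moreover have "l (res (g + h)) = l (res g) + l (res h)" for g h
    using l unfolding linear_functionals_def quot_add[symmetric] by (auto simp: res_in_carrier)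
  ultimately have "l (res (g + scalar c * h)) = l (res g) + c * l (res h)" for g h c
    by simp
  then show ?case by (intro exI[of _ "pCons (l (res f)) q"]) (simp add: q)
qed

text \<open>
  An open set that meets the curve contains \<open>g s\<close> for all but finitely many \<open>s\<close>, because a
  polynomial function that does not vanish on all of the curve has finitely many zeros in \<open>s\<close>.  Since
  \<open>k\<close> is infinite, two such open sets meet on the curve.
\<close>

lemma connectedin_polynomial_curve:
  fixes g :: "'k \<Rightarrow> ('n, 'k) kS set \<Rightarrow> ('n, 'k) kS set"
  assumes Aut: "\<And>s. s \<noteq> 0 \<Longrightarrow> g s \<in> Aut_quot I"
    and poly: "\<And>F. F \<in> polynomial_functions (quot_ring I) (quot_scalar I) \<Longrightarrow>
      \<exists>q. \<forall>s. F (g s) = poly q s"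
  shows "connectedin (Aut_zariski (quot_ring I) (quot_scalar I)) (g ` {s. s \<noteq> 0})"
  unfolding connectedin topspace_Aut_zariski
proof (intro conjI notI)
  let ?X = "Aut_zariski (quot_ring I) (quot_scalar I)"
  show "g ` {s. s \<noteq> 0} \<subseteq> Aut_quot I" using Aut by blast
  have open_poly: "\<exists>q. q \<noteq> 0 \<and> (\<forall>s. s \<noteq> 0 \<longrightarrow> poly q s \<noteq> 0 \<longrightarrow> g s \<in> E)"
    if E: "openin ?X E" "E \<inter> g ` {s. s \<noteq> 0} \<noteq> {}" for E
  proof -
    have "\<exists>P \<subseteq> polynomial_functions (quot_ring I) (quot_scalar I).
        E = {\<phi> \<in> Aut_quot I. \<exists>F\<in>P. F \<phi> \<noteq> 0}"
      using E(1) by (simp only: openin_Aut_zariski_iff)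
    then obtain P where P: "P \<subseteq> polynomial_functions (quot_ring I) (quot_scalar I)"
      "E = {\<phi> \<in> Aut_quot I. \<exists>F\<in>P. F \<phi> \<noteq> 0}"
      by (elim exE conjE)
    obtain s where "g s \<in> E" using E(2) by blast
    then obtain F where "F \<in> P" "F (g s) \<noteq> 0" unfolding P(2) by blast
    moreover obtain q where "\<And>s. F (g s) = poly q s"
      using poly P(1) \<open>F \<in> P\<close> by blast
    ultimately show ?thesis
      using P(2) Aut by (intro exI[of _ q]) (auto intro!: bexI[of _ F])
  qed
  assume "\<exists>E1 E2. openin ?X E1 \<and> openin ?X E2 \<and> g ` {s. s \<noteq> 0} \<subseteq> E1 \<union> E2 \<and>
    E1 \<inter> E2 \<inter> g ` {s. s \<noteq> 0} = {} \<and> E1 \<inter> g ` {s. s \<noteq> 0} \<noteq> {} \<and> E2 \<inter> g ` {s. s \<noteq> 0} \<noteq> {}"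
  then obtain E1 E2 where E: "openin ?X E1" "openin ?X E2"
    "E1 \<inter> E2 \<inter> g ` {s. s \<noteq> 0} = {}" "E1 \<inter> g ` {s. s \<noteq> 0} \<noteq> {}" "E2 \<inter> g ` {s. s \<noteq> 0} \<noteq> {}"
    by blast
  obtain q1 where q1: "q1 \<noteq> 0" "\<And>s. s \<noteq> 0 \<Longrightarrow> poly q1 s \<noteq> 0 \<Longrightarrow> g s \<in> E1"
    using open_poly[OF E(1,4)] by blast
  obtain q2 where q2: "q2 \<noteq> 0" "\<And>s. s \<noteq> 0 \<Longrightarrow> poly q2 s \<noteq> 0 \<Longrightarrow> g s \<in> E2"
    using open_poly[OF E(2,5)] by blast
  \<comment> \<open>the factor \<open>[:0, 1:]\<close> excludes the parameter \<open>s = 0\<close>\<close>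
  have "finite {s. poly (q1 * q2 * [:0, 1:]) s = 0}"
    using q1(1) q2(1) by (intro poly_roots_finite) simp
  then obtain s where "s \<notin> {s. poly (q1 * q2 * [:0, 1:]) s = 0}"
    using ex_new_if_finite[OF infinite_UNIV_char_0] by blast
  then have "s \<noteq> 0" "poly q1 s \<noteq> 0" "poly q2 s \<noteq> 0" by auto
  then show False using q1(2) q2(2) E(3) by blast
qed

text \<open>
  For an involution \<open>\<pi>\<close> of the variables, the substitution that fixes \<open>x a + x (\<pi> a)\<close> and multiplies
  \<open>x a - x (\<pi> a)\<close> by \<open>s\<close>.
\<close>

definition reflection_torus :: "('n \<Rightarrow> 'n) \<Rightarrow> 'k \<Rightarrow> 'n \<Rightarrow> ('n, 'k) kS" where
  "reflection_torus \<pi> s a = scalar (1 / 2) * (x a + x (\<pi> a)) + scalar s * (scalar (1 / 2) * (x a - x (\<pi> a)))"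

lemma half_scalar: "scalar (1 / 2) * f + scalar (1 / 2) * f = (f :: ('n, 'k) kS)"
proof -
  have "(1 / 2 + 1 / 2 :: 'k) = 1" by simp
  then show ?thesis by (metis distrib_right mult_1_left scalar_add scalar_1)
qed

lemma reflection_torus_1: "reflection_torus \<pi> 1 a = x a"
  using half_scalar[of "x a"] by (simp add: reflection_torus_def scalar_1 algebra_simps)

lemma reflection_torus_minus_1: "reflection_torus \<pi> (- 1) a = x (\<pi> a)"
proof -
  have "scalar (- 1) = (- 1 :: ('n, 'k) kS)"
    using scalar_add[of "- 1 :: 'k" 1] by (simp add: scalar_0 scalar_1 eq_neg_iff_add_eq_0)
  then show ?thesis
    using half_scalar[of "x (\<pi> a)"] by (simp add: reflection_torus_def algebra_simps)
qed

lemma reflection_torus_comp: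
  assumes "\<And>a. \<pi> (\<pi> a) = a"
  shows "subst (reflection_torus \<pi> s) (subst (reflection_torus \<pi> r) f) = subst (reflection_torus \<pi> (s * r)) f"
proof (induction f rule: kS_algebra_induct)
  case (var a)
  have plus: "reflection_torus \<pi> s a + reflection_torus \<pi> s (\<pi> a) = x a + x (\<pi> a)" for a
    using half_scalar[of "x a + x (\<pi> a)"] by (simp add: reflection_torus_def assms algebra_simps)
  have minus: "reflection_torus \<pi> s a - reflection_torus \<pi> s (\<pi> a) = scalar s * (x a - x (\<pi> a))" for a
  proof -
    have "reflection_torus \<pi> s a - reflection_torus \<pi> s (\<pi> a)
      = scalar s * (scalar (1 / 2) * (x a - x (\<pi> a)) + scalar (1 / 2) * (x a - x (\<pi> a)))"
      by (simp add: reflection_torus_def assms algebra_simps)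
    then show ?thesis by (simp only: half_scalar)
  qed
  have "subst (reflection_torus \<pi> s) (reflection_torus \<pi> r a)
    = scalar (1 / 2) * (reflection_torus \<pi> s a + reflection_torus \<pi> s (\<pi> a))
      + scalar r * (scalar (1 / 2) * (reflection_torus \<pi> s a - reflection_torus \<pi> s (\<pi> a)))"
    by (simp only: reflection_torus_def[of \<pi> r] subst_add subst_diff subst_mult subst_scalar subst_var)
  also have "\<dots> = reflection_torus \<pi> (s * r) a"
    unfolding plus minus by (simp add: reflection_torus_def scalar_mult mult_ac)
  finally show ?case by (simp only: subst_var)
qed (simp_all add: subst_scalar subst_add subst_mult)

text \<open>
  The substitutions \<open>reflection_torus \<pi> s\<close> preserve \<open>I\<close> and multiply like their parameters, so for
  \<open>s \<noteq> 0\<close> they induce automorphisms with inverse parameter \<open>1 / s\<close>.  They form a connected curve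
  through the identity at \<open>s = 1\<close> and \<open>\<tau>\<close> at \<open>s = -1\<close>.
\<close>

lemma swap_in_identity_component:
  assumes inv: "\<And>a. \<pi> (\<pi> a) = a" and ex: "\<And>a. exchange (\<pi> a) a"
    and \<tau>: "\<tau> \<in> Aut_quot I" and \<tau>_var: "\<And>a. \<tau> (res (x a)) = res (x (\<pi> a))"
  shows "\<tau> \<in> Aut0_quot I"
proof -
  let ?X = "Aut_zariski (quot_ring I) (quot_scalar I)"
  define G where "G s = subst (reflection_torus \<pi> s)" for s
  define g where "g s = induced (G s)" for s
  have G_I: "G s f \<in> I" if "f \<in> I" for s f
    unfolding G_def
  proof (rule subst_in_I[OF _ that])
    fix a f assume *: "\<And>b. exchange b a \<Longrightarrow> x b * f \<in> I"
    then have "x a * f \<in> I" "x (\<pi> a) * f \<in> I" using exchange_refl ex by blast+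
    then have "scalar (1 / 2) * (x a * f + x (\<pi> a) * f)
        + scalar s * (scalar (1 / 2) * (x a * f - x (\<pi> a) * f)) \<in> I"
      using I_mult_left I_add I_diff by simp
    then show "reflection_torus \<pi> s a * f \<in> I" by (simp add: reflection_torus_def algebra_simps)
  qed
  have g: "g s (res f) = res (G s f)" for s f
    unfolding g_def by (rule induced_res) (simp_all add: G_def subst_add G_I[unfolded G_def])
  have comp: "g s (g r C) = g (s * r) C" if "C \<in> carrier (quot_ring I)" for s r C
    using that by (auto simp: carrier_quot g G_def reflection_torus_comp inv)
  have "G 1 f = f" for f
    by (induction f rule: kS_algebra_induct)
      (simp_all add: G_def subst_scalar subst_add subst_mult subst_var reflection_torus_1)
  then have g_1: "g 1 C = C" if "C \<in> carrier (quot_ring I)" for C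
    using that by (auto simp: carrier_quot g)
  have g_ext: "g s \<in> extensional (carrier (quot_ring I))" for s
    by (simp add: g_def induced_def)
  have g_Aut: "g s \<in> Aut_quot I" if "s \<noteq> 0" for s
  proof -
    have "g s \<in> ring_hom (quot_ring I) (quot_ring I)"
    proof (rule ring_hom_memI)
      show "g s \<one>\<^bsub>quot_ring I\<^esub> = \<one>\<^bsub>quot_ring I\<^esub>"
        using subst_scalar[of "reflection_torus \<pi> s" 1] by (simp add: quot_one g G_def scalar_1)
    qed (auto simp: carrier_quot g quot_add quot_mult G_def subst_add subst_mult)
    moreover have "bij_betw (g s) (carrier (quot_ring I)) (carrier (quot_ring I))"
      by (rule bij_betwI[where g = "g (1 / s)"])
        (use that in \<open>auto simp: comp g_1\<close>, auto simp: carrier_quot g)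
    ultimately show ?thesis
      by (simp add: alg_automorphisms_def Bij_def g_ext g G_def subst_scalar)
  qed
  have g_poly: "\<exists>q. \<forall>s. F (g s) = poly q s"
    if "F \<in> polynomial_functions (quot_ring I) (quot_scalar I)" for F
    using that
  proof induction
    case (const c)
    show ?case by (rule exI[of _ "[:c:]"]) simp
  next
    case (entry l C)
    then obtain f where C: "C = res f" by (auto simp: carrier_quot)
    define V :: "'n \<Rightarrow> ('n, 'k) kS poly"
      where "V a = [:scalar (1 / 2) * (x a + x (\<pi> a)), scalar (1 / 2) * (x a - x (\<pi> a)):]" for a
    have "reflection_torus \<pi> s = (\<lambda>a. poly (V a) (scalar s))" for s
      by (rule ext) (simp add: reflection_torus_def V_def)
    then obtain Q where "\<And>s. G s f = poly Q (scalar s)"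
      using subst_polynomial[of V f] unfolding G_def by auto
    then show ?case using functional_of_polynomial[OF entry(1), of Q] by (simp add: C g)
  next
    case (add F H)
    then obtain p q where "\<And>s. F (g s) = poly p s" "\<And>s. H (g s) = poly q s" by blast
    then show ?case by (intro exI[of _ "p + q"]) simp
  next
    case (mult F H)
    then obtain p q where "\<And>s. F (g s) = poly p s" "\<And>s. H (g s) = poly q s" by blast
    then show ?case by (intro exI[of _ "p * q"]) simp
  qed
  have "connectedin ?X (g ` {s. s \<noteq> 0})"
    by (rule connectedin_polynomial_curve) (fact g_Aut, fact g_poly)
  moreover have "\<one>\<^bsub>alg_AutoGroup (quot_ring I) (quot_scalar I)\<^esub> \<in> g ` {s. s \<noteq> 0}"
  proof (rule image_eqI[of _ _ 1])
    show "\<one>\<^bsub>alg_AutoGroup (quot_ring I) (quot_scalar I)\<^esub> = g 1"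
      by (rule extensionalityI[OF _ g_ext]) (simp_all add: alg_AutoGroup_def BijGroup_def g_1)
  qed simp
  moreover have "\<tau> \<in> g ` {s. s \<noteq> 0}"
  proof (rule image_eqI[of _ _ "- 1"])
    have hom: "\<tau> \<in> ring_hom (quot_ring I) (quot_ring I)"
      and const: "\<And>c. \<tau> (res (scalar c)) = res (scalar c)"
      and \<tau>_ext: "\<tau> \<in> extensional (carrier (quot_ring I))"
      using \<tau> by (auto simp: alg_automorphisms_def Bij_def)
    have "\<tau> (res f) = res (G (- 1) f)" for f
    proof (induction f rule: kS_algebra_induct)
      case (add f h)
      then show ?case
        using ring_hom_add[OF hom res_in_carrier res_in_carrier, of f h]
        by (simp add: quot_add G_def subst_add)
    next
      case (mult f h)
      then show ?case
        using ring_hom_mult[OF hom res_in_carrier res_in_carrier, of f h]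
        by (simp add: quot_mult G_def subst_mult)
    qed (simp_all add: const \<tau>_var G_def subst_scalar subst_var reflection_torus_minus_1)
    then show "\<tau> = g (- 1)"
      by (intro extensionalityI[OF \<tau>_ext g_ext]) (auto simp: carrier_quot g)
  qed simp
  ultimately show ?thesis
    unfolding Aut_identity_component_def connected_component_of_def by blast
qed

end

theorem lemma4p17:
  fixes I :: "('n::finite, 'k::field_char_0) kS set"
    and i j :: 'n
    and \<sigma> :: "nat ^ 'n \<Rightarrow> nat ^ 'n"
    and \<tau> :: "('n, 'k) kS set \<Rightarrow> ('n, 'k) kS set"
  assumes "monomial_ideal I"
    and "full I"
    and "cofinite_support I"
    and "i \<noteq> j"
    and "semigroup_automorphism \<sigma>"
    and "\<sigma> (axis i 1) = axis j 1"
    and "\<sigma> (axis j 1) = axis i 1"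
    and "\<And>k. k \<noteq> i \<Longrightarrow> k \<noteq> j \<Longrightarrow> \<sigma> (axis k 1) = axis k 1"
    and "induces_toric_automorphism I \<sigma> \<tau>"
  shows "\<tau> \<in> Aut0_quot I \<longleftrightarrow>
    axis i 1 - axis j 1 \<in> root_set I \<and> axis j 1 - axis i 1 \<in> root_set I"
proof -
  interpret full_monomial_quotient I
    by unfold_locales (fact assms(1-3))+
  define \<pi> where "\<pi> = Transposition.transpose i j"
  have \<tau>: "\<tau> \<in> Aut_quot I" and \<tau>_X: "\<And>m. \<tau> (res (X_pow m)) = res (X_pow (\<sigma> m))"
    using assms(9) by (auto simp: induces_toric_automorphism_def)
  have \<tau>_var: "\<tau> (res (x a)) = res (x (\<pi> a))" for a
    using assms(6,7) assms(8)[of a] by (auto simp: \<tau>_X \<pi>_def Transposition.transpose_def)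
  have roots: "axis i 1 - axis j 1 \<in> root_set I \<longleftrightarrow> exchange i j"
    "axis j 1 - axis i 1 \<in> root_set I \<longleftrightarrow> exchange j i"
    using exchange_imp_root[of i j] root_imp_exchange[of i j]
      exchange_imp_root[of j i] root_imp_exchange[of j i] assms(4) by blast+
  show ?thesis
    unfolding roots
  proof
    assume "\<tau> \<in> Aut0_quot I"
    then show "exchange i j \<and> exchange j i"
      using \<tau>_var[of i] \<tau>_var[of j] by (auto simp: \<pi>_def intro: identity_component_exchange)
  next
    assume ex: "exchange i j \<and> exchange j i"
    show "\<tau> \<in> Aut0_quot I"
    proof (rule swap_in_identity_component[of \<pi>])
      show "exchange (\<pi> a) a" for a
        using ex exchange_refl by (auto simp: \<pi>_def Transposition.transpose_def)
    qed (simp_all add: \<pi>_def \<tau> \<tau>_var)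
  qed
qed

end
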